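(* Let $E$ be a complex Banach space and $\mathcal{A}$ a standard operator algebra on $E$. Fix a finite sequence $(i_1,\dots,i_m)$ with $\{i_1,\dots,i_m\}=\{1,\dots,k\}$, $k\ge 2$, such that some index $i_p$ occurs exactly once in the sequence, and consider the generalized product $T_1*\cdots*T_k=T_{i_1}\cdots T_{i_m}$ and the generalized Jordan product $T_1\circ\cdots\circ T_k=T_{i_1}\cdots T_{i_m}+T_{i_m}\cdots T_{i_1}$. Let $\phi:\mathcal{A}\to\mathcal{A}$ be a map (not assumed linear, additive or continuous). (i) Suppose the range of $\phi$ contains all operators on $E$ of rank at most two, and for any $a_1,\dots,a_k\in\mathcal{A}$ of which at least one has rank at most one there is an algebra automorphism $\theta_{a_1,\dots,a_k}$ of $\mathcal{A}$ with $\phi(a_1)*\cdots*\phi(a_k)=\theta_{a_1,\dots,a_k}(a_1*\cdots*a_k)$. (ii) Or suppose the range of $\phi$ contains all operators on $E$ of rank at most three, and for any $a_1,\dots,a_k\in\mathcal{A}$ of which at least one has rank at most one there is a linear Jordan automorphism $\theta_{a_1,\dots,a_k}$ of $\mathcal{A}$ with $\phi(a_1)\circ\cdots\circ\phi(a_k)=\theta_{a_1,\dots,a_k}(a_1\circ\cdots\circ a_k)$. In either case, there is a complex scalar $\xi$ with $\xi^m=1$ such that $\phi$ has either the form $A\mapsto \xi SAS^{-1}$ for an invertible bounded linear operator $S:E\to E$, or the form $A\mapsto \xi SA'S^{-1}$ for an invertible bounded linear operator $S:E'\to E$.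
   Context: $\mathcal{B}(E)$ is the algebra of bounded linear operators on $E$, $\mathcal{F}(E)$ its subalgebra of finite rank operators; a standard operator algebra on $E$ is a subalgebra of $\mathcal{B}(E)$ containing $\mathcal{F}(E)$. An algebra automorphism is a bijective linear multiplicative map. A linear Jordan automorphism is a bijective linear map $J$ with $J(ab+ba)=J(a)J(b)+J(b)J(a)$ for all $a,b$. $E'$ denotes the Banach dual of $E$ and $A':E'\to E'$ the dual (adjoint) operator of $A\in\mathcal{B}(E)$. *)

theory Defs
  imports "HOL-Analysis.Analysis"
begin

text \<open>A complex Banach space is modelled as a real Banach space (type class banach)
  together with a complex scalar multiplication smul extending the real one
  and satisfying the module axioms and absolute homogeneity of the norm.\<close>

definition complex_banach_scaling :: "(complex \<Rightarrow> 'a::banach \<Rightarrow> 'a) \<Rightarrow> bool" where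
  "complex_banach_scaling smul \<longleftrightarrow>
     (\<forall>r x. smul (complex_of_real r) x = r *\<^sub>R x) \<and>
     (\<forall>c x y. smul c (x + y) = smul c x + smul c y) \<and>
     (\<forall>c d x. smul (c + d) x = smul c x + smul d x) \<and>
     (\<forall>c d x. smul (c * d) x = smul c (smul d x)) \<and>
     (\<forall>c x. norm (smul c x) = norm c * norm x)"

definition bounded_clinear_op :: "(complex \<Rightarrow> 'a::banach \<Rightarrow> 'a) \<Rightarrow> ('a \<Rightarrow> 'a) \<Rightarrow> bool" where
  "bounded_clinear_op smul T \<longleftrightarrow> bounded_linear T \<and> (\<forall>c x. T (smul c x) = smul c (T x))"

definition cspan_list :: "(complex \<Rightarrow> 'a::banach \<Rightarrow> 'a) \<Rightarrow> 'a list \<Rightarrow> 'a set" where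
  "cspan_list smul vs = {(\<Sum>i<length vs. smul (c i) (vs ! i)) | c. True}"

definition rank_le :: "(complex \<Rightarrow> 'a::banach \<Rightarrow> 'a) \<Rightarrow> ('a \<Rightarrow> 'a) \<Rightarrow> nat \<Rightarrow> bool" where
  "rank_le smul T n \<longleftrightarrow> (\<exists>vs. length vs \<le> n \<and> range T \<subseteq> cspan_list smul vs)"

definition finite_rank :: "(complex \<Rightarrow> 'a::banach \<Rightarrow> 'a) \<Rightarrow> ('a \<Rightarrow> 'a) \<Rightarrow> bool" where
  "finite_rank smul T \<longleftrightarrow> (\<exists>n. rank_le smul T n)"

definition standard_operator_algebra :: "(complex \<Rightarrow> 'a::banach \<Rightarrow> 'a) \<Rightarrow> ('a \<Rightarrow> 'a) set \<Rightarrow> bool" where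
  "standard_operator_algebra smul \<A> \<longleftrightarrow>
     (\<forall>T\<in>\<A>. bounded_clinear_op smul T) \<and>
     (\<forall>S\<in>\<A>. \<forall>T\<in>\<A>. (\<lambda>x. S x + T x) \<in> \<A>) \<and>
     (\<forall>S\<in>\<A>. \<forall>T\<in>\<A>. S \<circ> T \<in> \<A>) \<and>
     (\<forall>c. \<forall>T\<in>\<A>. (\<lambda>x. smul c (T x)) \<in> \<A>) \<and>
     {T. bounded_clinear_op smul T \<and> finite_rank smul T} \<subseteq> \<A>"

definition alg_linear_bij :: "(complex \<Rightarrow> 'a::banach \<Rightarrow> 'a) \<Rightarrow> ('a \<Rightarrow> 'a) set
     \<Rightarrow> (('a \<Rightarrow> 'a) \<Rightarrow> ('a \<Rightarrow> 'a)) \<Rightarrow> bool" where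
  "alg_linear_bij smul \<A> \<theta> \<longleftrightarrow> bij_betw \<theta> \<A> \<A> \<and>
     (\<forall>S\<in>\<A>. \<forall>T\<in>\<A>. \<theta> (\<lambda>x. S x + T x) = (\<lambda>x. \<theta> S x + \<theta> T x)) \<and>
     (\<forall>c. \<forall>T\<in>\<A>. \<theta> (\<lambda>x. smul c (T x)) = (\<lambda>x. smul c (\<theta> T x)))"

definition algebra_automorphism where
  "algebra_automorphism smul \<A> \<theta> \<longleftrightarrow> alg_linear_bij smul \<A> \<theta> \<and>
     (\<forall>S\<in>\<A>. \<forall>T\<in>\<A>. \<theta> (S \<circ> T) = \<theta> S \<circ> \<theta> T)"

definition jordan_automorphism where
  "jordan_automorphism smul \<A> \<theta> \<longleftrightarrow> alg_linear_bij smul \<A> \<theta> \<and>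
     (\<forall>S\<in>\<A>. \<forall>T\<in>\<A>. \<theta> (\<lambda>x. S (T x) + T (S x)) = (\<lambda>x. \<theta> S (\<theta> T x) + \<theta> T (\<theta> S x)))"

definition gen_prod :: "nat list \<Rightarrow> (nat \<Rightarrow> ('a \<Rightarrow> 'a)) \<Rightarrow> ('a \<Rightarrow> 'a)" where
  "gen_prod is T = foldr (\<circ>) (map T is) id"

definition gen_jordan_prod :: "nat list \<Rightarrow> (nat \<Rightarrow> ('a::plus \<Rightarrow> 'a)) \<Rightarrow> ('a \<Rightarrow> 'a)" where
  "gen_jordan_prod is T = (\<lambda>x. gen_prod is T x + gen_prod (rev is) T x)"

definition cdual :: "(complex \<Rightarrow> 'a::banach \<Rightarrow> 'a) \<Rightarrow> ('a \<Rightarrow> complex) set" where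
  "cdual smul = {f. bounded_linear f \<and> (\<forall>c x. f (smul c x) = c * f x)}"

definition invertible_op :: "(complex \<Rightarrow> 'a::banach \<Rightarrow> 'a) \<Rightarrow> ('a \<Rightarrow> 'a) \<Rightarrow> bool" where
  "invertible_op smul S \<longleftrightarrow> bounded_clinear_op smul S \<and> bij S"

definition invertible_dual_op :: "(complex \<Rightarrow> 'a::banach \<Rightarrow> 'a) \<Rightarrow> (('a \<Rightarrow> complex) \<Rightarrow> 'a) \<Rightarrow> bool" where
  "invertible_dual_op smul S \<longleftrightarrow> bij_betw S (cdual smul) UNIV \<and>
     (\<forall>f\<in>cdual smul. \<forall>g\<in>cdual smul. S (\<lambda>x. f x + g x) = S f + S g) \<and>
     (\<forall>c. \<forall>f\<in>cdual smul. S (\<lambda>x. c * f x) = smul c (S f)) \<and>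
     (\<exists>K. \<forall>f\<in>cdual smul. norm (S f) \<le> K * onorm f)"

end

theory Submission
  imports Defs
begin

text \<open>Giving all variables other than the one that occurs once the same value A turns the product into
  \<open>A\<^sup>r B A\<^sup>s\<close>. Jordan automorphisms preserve rank one operators and their traces, so comparing traces
  shows that \<open>\<phi>\<close> is linear on operators of rank one. For a rank one idempotent P, the power
  \<open>\<phi>(P)\<^bsup>m\<^esup>\<close> is a rank one idempotent; a nonzero nilpotent part of \<open>\<phi>(P)\<close> would be detected by a
  suitable operator of rank two (or three) in the range of \<open>\<phi>\<close>. Hence, up to a root of unity \<open>\<xi>\<close>,
  \<open>\<phi>\<close> preserves rank one and the trace form, so on rank one operators it is \<open>x \<otimes> f \<mapsto> Sx \<otimes> Cf\<close> or
  \<open>x \<otimes> f \<mapsto> Sf \<otimes> Cx\<close>. The trace form extends this to the whole algebra, and the range condition makes S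
  bijective and, by Hahn-Banach and Baire, bounded.\<close>

section \<open>Norming functionals and weak boundedness\<close>

text \<open>The automorphism changes with the arguments, so only what every Jordan automorphism
  respects can be compared: rank at most one, and the trace there. The product hypothesis is used
  from both sides. With B = \<open>x \<odot> f\<close> and A a preimage of an idempotent
  \<open>y \<odot> g\<close> it gives \<open>g (\<phi> (x \<odot> f) y) = f (A^(m-1) x)\<close>; A
  does not depend on x and f, and the right side is linear in each, which is where linearity of
  \<open>\<phi>\<close> comes from. With A of rank one and B arbitrary it gives the trace form on
  the whole algebra. The ranks two and three are those of the test operators against a nilpotent
  part: a product with a rank one factor has rank at most one, a Jordan product rank at most two,
  and the test must produce one more. If the single index sits in the middle, the Jordan product is
  twice the ordinary product and is treated as such. The root of unity comes from B = A: the traces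
  of \<open>\<phi> (x \<odot> f)\<close> and of \<open>x \<odot> f\<close> have equal m-th powers,
  hence the same zeros, and two bilinear forms with the same zeros are proportional.\<close>

definition norm_sublinear :: "('a::real_normed_vector \<Rightarrow> real) \<Rightarrow> bool" where
  "norm_sublinear p \<longleftrightarrow> (\<forall>x y. p (x + y) \<le> p x + p y) \<and>
     (\<forall>c x. 0 \<le> c \<longrightarrow> p (c *\<^sub>R x) \<le> c * p x) \<and> (\<forall>x. p x \<le> norm x)"

lemma norm_sublinear_norm: "norm_sublinear norm"
  by (auto simp: norm_sublinear_def norm_triangle_ineq)

lemma norm_sublinear_zero:
  assumes "norm_sublinear p" shows "p 0 = 0"
proof -
  have "p 0 \<le> 0" using assms unfolding norm_sublinear_def by (metis norm_zero)
  moreover have "p (0 + 0) \<le> p 0 + p 0" using assms unfolding norm_sublinear_def by blast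
  ultimately show ?thesis by simp
qed

lemma norm_sublinear_scaleR:
  assumes "norm_sublinear p" "0 \<le> c" shows "p (c *\<^sub>R x) = c * p x"
proof (cases "c = 0")
  case True then show ?thesis using norm_sublinear_zero[OF assms(1)] by simp
next
  case False
  have "p (inverse c *\<^sub>R (c *\<^sub>R x)) \<le> inverse c * p (c *\<^sub>R x)"
    using assms unfolding norm_sublinear_def by (metis inverse_nonnegative_iff_nonnegative)
  hence "c * p x \<le> p (c *\<^sub>R x)" using False assms(2) by (simp add: field_simps)
  moreover have "p (c *\<^sub>R x) \<le> c * p x" using assms unfolding norm_sublinear_def by blast
  ultimately show ?thesis by simp
qed

lemma norm_sublinear_lower:
  assumes "norm_sublinear p" shows "- norm x \<le> p x"
proof -
  have "p (x + - x) \<le> p x + p (- x)" "p (- x) \<le> norm (- x)"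
    using assms unfolding norm_sublinear_def by blast+
  thus ?thesis using norm_sublinear_zero[OF assms] by simp
qed

text \<open>Zorn's lemma downwards: the lower bound of a chain is its pointwise infimum, which
  exists because every member stays above \<open>- norm x\<close>.\<close>

lemma minimal_norm_sublinear:
  fixes p :: "'a::real_normed_vector \<Rightarrow> real"
  assumes p: "norm_sublinear p"
  obtains q where "norm_sublinear q" "q \<le> p" "\<And>q'. norm_sublinear q' \<Longrightarrow> q' \<le> q \<Longrightarrow> q' = q"
proof -
  define A where "A = {q. norm_sublinear q \<and> q \<le> p}"
  have "\<exists>m\<in>A. \<forall>a\<in>A. a \<le> m \<longrightarrow> a = m"
  proof (rule predicate_Zorn[where P = "\<lambda>a b. b \<le> a"])
    show "partial_order_on A (relation_of (\<lambda>a b. b \<le> a) A)"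
      by (auto simp: partial_order_on_def preorder_on_def relation_of_def refl_on_def trans_def antisym_def)
  next
    fix C assume C: "C \<in> Chains (relation_of (\<lambda>a b. b \<le> a) A)"
    have CA: "C \<subseteq> A" and ch: "\<And>a b. a \<in> C \<Longrightarrow> b \<in> C \<Longrightarrow> a \<le> b \<or> b \<le> a"
      using C by (auto simp: Chains_def relation_of_def)
    show "\<exists>u\<in>A. \<forall>a\<in>C. u \<le> a"
    proof (cases "C = {}")
      case True
      thus ?thesis using p by (auto simp: A_def)
    next
      case False
      then obtain a0 where a0: "a0 \<in> C" by blast
      have sl: "norm_sublinear a" if "a \<in> C" for a using that CA by (auto simp: A_def)
      define u where "u x = (INF a\<in>C. a x)" for x
      have bdd: "bdd_below ((\<lambda>a. a x) ` C)" for x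
        by (rule bdd_belowI2[where m = "- norm x"]) (use norm_sublinear_lower sl in blast)
      have ule: "u x \<le> a x" if "a \<in> C" for a x
        unfolding u_def by (rule cINF_lower[OF bdd that])
      have uge: "c \<le> u x" if "\<And>a. a \<in> C \<Longrightarrow> c \<le> a x" for c x
        unfolding u_def by (rule cINF_greatest[OF False]) (use that in auto)
      have "u (x + y) \<le> u x + u y" for x y
      proof -
        have 1: "u (x + y) - a x \<le> b y" if ab: "a \<in> C" "b \<in> C" for a b
        proof -
          \<comment> \<open>A pointwise infimum of sublinear functionals need not be sublinear;
            along a chain the smaller of a and b bounds both summands at once.\<close>
          obtain d where d: "d \<in> C" "d \<le> a" "d \<le> b" using ch[OF ab] ab by (metis order_refl)
          have "u (x + y) \<le> d (x + y)" using ule d by blast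
          also have "\<dots> \<le> d x + d y" using sl[OF d(1)] by (simp add: norm_sublinear_def)
          also have "\<dots> \<le> a x + b y" using d by (simp add: le_fun_def add_mono)
          finally show ?thesis by simp
        qed
        have "u (x + y) - a x \<le> u y" if "a \<in> C" for a by (rule uge) (rule 1[OF that])
        hence "u (x + y) - u y \<le> u x" by (intro uge) (simp add: algebra_simps)
        thus ?thesis by simp
      qed
      moreover have "u (c *\<^sub>R x) \<le> c * u x" if "0 \<le> c" for c x
      proof (cases "c = 0")
        case True
        have "u 0 \<le> a0 0" by (rule ule[OF a0])
        thus ?thesis using True norm_sublinear_zero[OF sl[OF a0]] by simp
      next
        case False
        hence c: "0 < c" using that by simp
        have "u (c *\<^sub>R x) / c \<le> u x"
        proof (rule uge)
          fix a assume a: "a \<in> C"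
          have "u (c *\<^sub>R x) \<le> a (c *\<^sub>R x)" by (rule ule[OF a])
          also have "\<dots> \<le> c * a x" using sl[OF a] that by (simp add: norm_sublinear_def)
          finally show "u (c *\<^sub>R x) / c \<le> a x" using c by (simp add: field_simps)
        qed
        thus ?thesis using c by (simp add: field_simps)
      qed
      moreover have "u x \<le> norm x" for x
      proof -
        have "u x \<le> a0 x" by (rule ule[OF a0])
        also have "\<dots> \<le> norm x" using sl[OF a0] by (simp add: norm_sublinear_def)
        finally show ?thesis .
      qed
      ultimately have "norm_sublinear u" by (simp add: norm_sublinear_def)
      moreover have "u \<le> p"
        using ule[OF a0] a0 CA by (force simp: A_def le_fun_def intro: order_trans)
      ultimately have "u \<in> A" by (simp add: A_def)
      thus ?thesis using ule by (auto simp: le_fun_def)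
    qed
  qed
  then obtain m where m: "m \<in> A" "\<And>a. a \<in> A \<Longrightarrow> a \<le> m \<Longrightarrow> a = m" by blast
  show ?thesis
  proof (rule that[of m])
    show "norm_sublinear m" "m \<le> p" using m(1) by (auto simp: A_def)
    fix q' assume "norm_sublinear q'" "q' \<le> m"
    thus "q' = m" using m by (auto simp: A_def intro: order_trans)
  qed
qed

text \<open>The witness is the infimum of \<open>p (x + t a) - t p a\<close> over
  \<open>t \<ge> 0\<close>: t = 0 puts it below p, and t = 1 gives the last conclusion. If p is
  minimal, the witness equals p, and then \<open>p x + p a \<le> p (x + a)\<close>.\<close>

lemma norm_sublinear_shift:
  fixes p :: "'a::real_normed_vector \<Rightarrow> real"
  assumes p: "norm_sublinear p"
  obtains q where "norm_sublinear q" "q \<le> p" "\<And>x. q x \<le> p (x + a) - p a"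
proof -
  define q where "q x = (INF t\<in>{0..}. p (x + t *\<^sub>R a) - t * p a)" for x
  have add: "p (x + y) \<le> p x + p y" for x y using p by (simp add: norm_sublinear_def)
  have bdd: "bdd_below ((\<lambda>t. p (x + t *\<^sub>R a) - t * p a) ` {0..})" for x
  proof (rule bdd_belowI2[where m = "- p (- x)"])
    fix t :: real assume "t \<in> {0..}"
    hence "t * p a = p ((x + t *\<^sub>R a) + - x)" using norm_sublinear_scaleR[OF p, of t a] by simp
    also have "\<dots> \<le> p (x + t *\<^sub>R a) + p (- x)" by (rule add)
    finally show "- p (- x) \<le> p (x + t *\<^sub>R a) - t * p a" by simp
  qed
  have qle: "q x \<le> p (x + t *\<^sub>R a) - t * p a" if "0 \<le> t" for x t
    unfolding q_def using that by (intro cINF_lower[OF bdd]) auto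
  have qge: "c \<le> q x" if "\<And>t. 0 \<le> t \<Longrightarrow> c \<le> p (x + t *\<^sub>R a) - t * p a" for c x
    unfolding q_def by (rule cINF_greatest) (use that in auto)
  have "q (x + y) \<le> q x + q y" for x y
  proof -
    have 1: "q (x + y) - (p (x + t *\<^sub>R a) - t * p a) \<le> p (y + t' *\<^sub>R a) - t' * p a"
      if "0 \<le> t" "0 \<le> t'" for t t'
    proof -
      have "q (x + y) \<le> p ((x + y) + (t + t') *\<^sub>R a) - (t + t') * p a"
        using that by (intro qle) simp
      moreover have "p ((x + t *\<^sub>R a) + (y + t' *\<^sub>R a)) \<le> p (x + t *\<^sub>R a) + p (y + t' *\<^sub>R a)" by (rule add)
      ultimately show ?thesis by (simp add: algebra_simps)
    qed
    have "q (x + y) - (p (x + t *\<^sub>R a) - t * p a) \<le> q y" if "0 \<le> t" for t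
      by (rule qge) (rule 1[OF that])
    hence "q (x + y) - q y \<le> q x" by (intro qge) (force simp: algebra_simps)
    thus ?thesis by simp
  qed
  moreover have "q (c *\<^sub>R x) \<le> c * q x" if "0 \<le> c" for c x
  proof (cases "c = 0")
    case True
    thus ?thesis using qle[of 0 0] norm_sublinear_zero[OF p] by simp
  next
    case False
    hence c: "0 < c" using that by simp
    have "q (c *\<^sub>R x) / c \<le> q x"
    proof (rule qge)
      fix t :: real assume t: "0 \<le> t"
      have "q (c *\<^sub>R x) \<le> p (c *\<^sub>R x + (c * t) *\<^sub>R a) - (c * t) * p a"
        using t that by (intro qle) simp
      also have "c *\<^sub>R x + (c * t) *\<^sub>R a = c *\<^sub>R (x + t *\<^sub>R a)" by (simp add: scaleR_add_right)
      also have "p \<dots> = c * p (x + t *\<^sub>R a)" by (rule norm_sublinear_scaleR[OF p that])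
      finally show "q (c *\<^sub>R x) / c \<le> p (x + t *\<^sub>R a) - t * p a" using c by (simp add: field_simps)
    qed
    thus ?thesis using c by (simp add: field_simps)
  qed
  moreover have qp: "q x \<le> p x" for x using qle[of 0 x] by simp
  moreover have "q x \<le> norm x" for x using qp[of x] p by (force simp: norm_sublinear_def intro: order_trans)
  ultimately have "norm_sublinear q" by (simp add: norm_sublinear_def)
  thus ?thesis using that[of q] qp qle[of 1] by (auto simp: le_fun_def)
qed

text \<open>Hahn-Banach: a minimal sublinear functional below the norm is linear, because shifting it
  in any direction cannot make it smaller.\<close>

lemma exists_norming_functional:
  fixes y :: "'a::real_normed_vector"
  obtains \<rho> :: "'a \<Rightarrow> real"
  where "bounded_linear \<rho>" "\<And>x. \<bar>\<rho> x\<bar> \<le> norm x" "\<rho> y = norm y"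
proof -
  \<comment> \<open>Shifting the norm by y before minimizing forces
    \<open>p (- y) \<le> - norm y\<close>, so the linear functional below p attains the norm at
    y.\<close>
  obtain p where p: "norm_sublinear p" "\<And>x. p x \<le> norm (x + y) - norm y"
    by (rule norm_sublinear_shift[OF norm_sublinear_norm, of y]) blast
  obtain q where q: "norm_sublinear q" "q \<le> p" "\<And>q'. norm_sublinear q' \<Longrightarrow> q' \<le> q \<Longrightarrow> q' = q"
    by (rule minimal_norm_sublinear[OF p(1)]) blast
  have add: "q (x + a) = q x + q a" for x a
  proof -
    obtain q' where q': "norm_sublinear q'" "q' \<le> q" "\<And>x. q' x \<le> q (x + a) - q a"
      by (rule norm_sublinear_shift[OF q(1), of a]) blast
    have "q' = q" using q(3) q' by blast
    hence "q x + q a \<le> q (x + a)" using q'(3)[of x] by simp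
    thus ?thesis using q(1) unfolding norm_sublinear_def by (meson antisym)
  qed
  have neg: "q (- x) = - q x" for x using add[of x "- x"] norm_sublinear_zero[OF q(1)] by simp
  have scale: "q (c *\<^sub>R x) = c * q x" for c x
  proof (cases "0 \<le> c")
    case True thus ?thesis by (rule norm_sublinear_scaleR[OF q(1)])
  next
    case False
    hence "q ((- c) *\<^sub>R x) = - c * q x" by (intro norm_sublinear_scaleR[OF q(1)]) simp
    thus ?thesis using neg[of "c *\<^sub>R x"] by simp
  qed
  have le: "\<bar>q x\<bar> \<le> norm x" for x
    using q(1) norm_sublinear_lower[OF q(1), of x] by (auto simp: norm_sublinear_def abs_le_iff neg[symmetric])
      (metis neg norm_minus_cancel)
  have bl: "bounded_linear q"
    by (rule bounded_linear_intro[where K = 1]) (use add scale le in auto)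
  have "q (- y) \<le> p (- y)" using q(2) by (simp add: le_fun_def)
  also have "\<dots> \<le> - norm y" using p(2)[of "- y"] by simp
  finally have "q y = norm y" using neg le[of y] by simp
  with bl le that show ?thesis by blast
qed

text \<open>A uniform boundedness argument. Since the norm is the maximum over the functionals in
  \<open>G\<close>, each sublevel set \<open>V n\<close> is an intersection of closed sets, and
  Baire finds one with interior. It serves for maps of which only the compositions with functionals
  are known to be continuous.\<close>

lemma bounded_if_weakly_bounded:
  fixes L :: "'x::banach \<Rightarrow> 'y::real_normed_vector"
  assumes lin: "linear L"
    and weak: "\<And>\<rho>. bounded_linear \<rho> \<Longrightarrow> (\<And>y. \<bar>\<rho> y\<bar> \<le> norm y) \<Longrightarrow> continuous_on UNIV (\<lambda>x. \<rho> (L x) :: real)"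
  obtains K where "0 \<le> K" "\<And>x. norm (L x) \<le> K * norm x"
proof -
  define G where "G = {\<rho> :: 'y \<Rightarrow> real. bounded_linear \<rho> \<and> (\<forall>y. \<bar>\<rho> y\<bar> \<le> norm y)}"
  define V where "V n = {x. norm (L x) \<le> real n}" for n :: nat
  have V_eq: "V n = (\<Inter>\<rho>\<in>G. {x. \<rho> (L x) \<le> real n})" for n
  proof (intro equalityI subsetI)
    fix x assume "x \<in> V n"
    thus "x \<in> (\<Inter>\<rho>\<in>G. {x. \<rho> (L x) \<le> real n})"
      unfolding V_def G_def by (auto intro: order_trans[OF abs_ge_self order_trans])
  next
    fix x assume x: "x \<in> (\<Inter>\<rho>\<in>G. {x. \<rho> (L x) \<le> real n})"
    obtain \<rho> :: "'y \<Rightarrow> real" where "bounded_linear \<rho>" "\<And>y. \<bar>\<rho> y\<bar> \<le> norm y" "\<rho> (L x) = norm (L x)"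
      by (rule exists_norming_functional[of "L x"]) blast
    with x show "x \<in> V n" by (auto simp: V_def G_def)
  qed
  have closed: "closed (V n)" for n
    unfolding V_eq using weak by (intro closed_INT ballI closed_Collect_le) (auto simp: G_def intro: continuous_on_const)
  have "\<Union>(range V) = UNIV" by (auto simp: V_def real_arch_simple)
  have "\<exists>n. interior (V n) \<noteq> {}"
  proof (rule ccontr)
    assume "\<not> ?thesis"
    hence "Met_TC.mtopology interior_of \<Union>(range V) = {}"
      using closed complete_UNIV by (intro Met_TC.metric_Baire_category_alt) auto
    thus False using \<open>\<Union>(range V) = UNIV\<close> by simp
  qed
  then obtain n x0 where "x0 \<in> interior (V n)" by blast
  then obtain e where e: "0 < e" "ball x0 e \<subseteq> V n" by (auto simp: mem_interior)
  \<comment> \<open>The centre of the ball is subtracted, at the price of doubling the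
    bound.\<close>
  have small: "norm (L x) \<le> 2 * real n" if "norm x < e" for x
  proof -
    have "x0 + x \<in> V n" "x0 \<in> V n" using that e by (auto simp: subset_iff dist_norm)
    hence "norm (L (x0 + x)) \<le> n" "norm (L x0) \<le> n" by (auto simp: V_def)
    moreover have "L x = L (x0 + x) - L x0" using lin by (simp add: linear_add)
    ultimately show ?thesis by (smt (verit) norm_triangle_ineq4)
  qed
  show ?thesis
  proof (rule that[of "4 * real n / e"])
    show "0 \<le> 4 * real n / e" using e by simp
    fix x
    show "norm (L x) \<le> 4 * real n / e * norm x"
    proof (cases "x = 0")
      case True thus ?thesis using lin by (simp add: linear_0)
    next
      case False
      define c where "c = e / (2 * norm x)"
      have c: "0 < c" using e False by (simp add: c_def)
      have "norm (L (c *\<^sub>R x)) \<le> 2 * real n"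
        by (rule small) (use e False in \<open>simp add: c_def\<close>)
      hence "c * norm (L x) \<le> 2 * real n" using lin c by (simp add: linear_scale)
      hence "norm (L x) \<le> 2 * real n / c" using c by (simp add: field_simps)
      thus ?thesis by (simp add: c_def field_simps)
    qed
  qed
qed

section \<open>Rank one operators and their trace\<close>

locale complex_banach =
  fixes smul :: "complex \<Rightarrow> 'a::banach \<Rightarrow> 'a"
  assumes cb: "complex_banach_scaling smul"
begin

sublocale cv: vector_space smul
proof
  fix a b x y
  show "smul a (x + y) = smul a x + smul a y" "smul (a + b) x = smul a x + smul b x"
    "smul a (smul b x) = smul (a * b) x"
    using cb by (auto simp: complex_banach_scaling_def)
  have "smul (complex_of_real 1) x = 1 *\<^sub>R x"
    using cb unfolding complex_banach_scaling_def by blast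
  thus "smul 1 x = x" by simp
qed

lemma smul_of_real: "smul (complex_of_real r) x = r *\<^sub>R x"
  using cb unfolding complex_banach_scaling_def by blast

lemma norm_smul [simp]: "norm (smul c x) = norm c * norm x"
  using cb unfolding complex_banach_scaling_def by blast

lemma smul_left_eqD: "smul c x = smul d x \<Longrightarrow> x \<noteq> 0 \<Longrightarrow> c = d"
  using cv.scale_right_imp_eq by blast

lemma smul_Complex: "smul c x = Re c *\<^sub>R x + Im c *\<^sub>R smul \<i> x"
proof -
  have "c = complex_of_real (Re c) + complex_of_real (Im c) * \<i>" by (simp add: complex_eq_iff)
  hence "smul c x = smul (complex_of_real (Re c) + complex_of_real (Im c) * \<i>) x" by (rule arg_cong)
  also have "\<dots> = smul (complex_of_real (Re c)) x + smul (complex_of_real (Im c)) (smul \<i> x)"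
    by (simp only: cv.scale_left_distrib cv.scale_scale)
  finally show ?thesis by (simp only: smul_of_real)
qed

lemma bounded_linear_smul: "bounded_linear (smul c)"
proof (rule bounded_linear_intro[where K = "norm c"])
  fix r x
  have "smul c (smul (complex_of_real r) x) = smul (complex_of_real r) (smul c x)"
    by (simp add: mult.commute)
  thus "smul c (r *\<^sub>R x) = r *\<^sub>R smul c x" by (simp only: smul_of_real)
qed (auto simp: cv.scale_right_distrib)

abbreviation dual :: "('a \<Rightarrow> complex) set" where "dual \<equiv> cdual smul"

abbreviation bop :: "('a \<Rightarrow> 'a) \<Rightarrow> bool" where "bop \<equiv> bounded_clinear_op smul"

lemma dualD:
  assumes "f \<in> dual"
  shows "bounded_linear f" "f (x + y) = f x + f y" "f (smul c x) = c * f x" "f 0 = 0"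
    "f (x - y) = f x - f y" "f (- x) = - f x"
proof -
  show bl: "bounded_linear f" and "f (smul c x) = c * f x" using assms by (auto simp: cdual_def)
  show "f (x + y) = f x + f y" "f 0 = 0" "f (x - y) = f x - f y" "f (- x) = - f x"
    using bl by (auto simp: linear_simps)
qed

lemma dual_add [intro]: "f \<in> dual \<Longrightarrow> g \<in> dual \<Longrightarrow> (\<lambda>x. f x + g x) \<in> dual"
  by (auto simp: cdual_def bounded_linear_add algebra_simps)

lemma dual_diff [intro]: "f \<in> dual \<Longrightarrow> g \<in> dual \<Longrightarrow> (\<lambda>x. f x - g x) \<in> dual"
  by (auto simp: cdual_def bounded_linear_sub algebra_simps)

lemma dual_scale [intro]: "f \<in> dual \<Longrightarrow> (\<lambda>x. c * f x) \<in> dual"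
  by (auto simp: cdual_def bounded_linear_const_mult algebra_simps)

lemma dual_zero [simp]: "(\<lambda>x. 0) \<in> dual"
  by (simp add: cdual_def)

lemma dual_comp: "f \<in> dual \<Longrightarrow> bop T \<Longrightarrow> (\<lambda>x. f (T x)) \<in> dual"
  by (auto simp: cdual_def bounded_clinear_op_def bounded_linear_compose)

lemma bopD:
  assumes "bop T"
  shows "bounded_linear T" "T (x + y) = T x + T y" "T (smul c x) = smul c (T x)" "T 0 = 0"
    "T (x - y) = T x - T y" "T (- x) = - T x"
proof -
  show bl: "bounded_linear T" and "T (smul c x) = smul c (T x)"
    using assms by (auto simp: bounded_clinear_op_def)
  show "T (x + y) = T x + T y" "T 0 = 0" "T (x - y) = T x - T y" "T (- x) = - T x"
    using bl by (auto simp: linear_simps)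
qed

lemma bop_add [intro]: "bop S \<Longrightarrow> bop T \<Longrightarrow> bop (\<lambda>x. S x + T x)"
  by (auto simp: bounded_clinear_op_def bounded_linear_add cv.scale_right_distrib)

lemma bop_scale [intro]: "bop T \<Longrightarrow> bop (\<lambda>x. smul c (T x))"
  using bounded_linear_compose[OF bounded_linear_smul]
  by (auto simp: bounded_clinear_op_def mult.commute)

lemma bop_comp [intro]: "bop S \<Longrightarrow> bop T \<Longrightarrow> bop (S \<circ> T)"
  by (auto simp: bounded_clinear_op_def comp_def bounded_linear_compose)

lemma bop_funpow [intro]: "bop T \<Longrightarrow> bop (T ^^ j)"
proof (induction j)
  case 0
  show ?case by (simp add: bounded_clinear_op_def id_def bounded_linear_ident)
next
  case (Suc j)
  thus ?case by (metis funpow.simps(2) bop_comp)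
qed

text \<open>A complex functional is recovered from its real part by
  \<open>\<rho> u - \<i> \<rho> (\<i> u)\<close>; this carries the real Hahn-Banach theorem over to
  \<open>dual\<close>.\<close>

lemma complexification_in_dual:
  fixes \<rho> :: "'a \<Rightarrow> real"
  assumes "bounded_linear \<rho>"
  shows "(\<lambda>u. Complex (\<rho> u) (- \<rho> (smul \<i> u))) \<in> dual"
proof -
  note lin = linear_simps[OF assms]
  obtain K where K: "\<And>x. norm (\<rho> x) \<le> norm x * K" using bounded_linear.bounded[OF assms] by blast
  have i: "smul \<i> (r *\<^sub>R x) = r *\<^sub>R smul \<i> x" for r x
    by (rule linear_simps(5)[OF bounded_linear_smul])
  have "bounded_linear (\<lambda>u. Complex (\<rho> u) (- \<rho> (smul \<i> u)))"
  proof (rule bounded_linear_intro[where K = "2 * K"])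
    fix u
    have "cmod (Complex (\<rho> u) (- \<rho> (smul \<i> u))) \<le> \<bar>\<rho> u\<bar> + \<bar>\<rho> (smul \<i> u)\<bar>"
      using cmod_le[of "Complex (\<rho> u) (- \<rho> (smul \<i> u))"] by simp
    thus "cmod (Complex (\<rho> u) (- \<rho> (smul \<i> u))) \<le> norm u * (2 * K)"
      using K[of u] K[of "smul \<i> u"] by simp
  qed (auto simp: lin cv.scale_right_distrib i complex_eq_iff)
  moreover have "Complex (\<rho> (smul c u)) (- \<rho> (smul \<i> (smul c u))) = c * Complex (\<rho> u) (- \<rho> (smul \<i> u))" for c u
  proof -
    have "\<rho> (smul d u) = Re d * \<rho> u + Im d * \<rho> (smul \<i> u)" for d
      by (subst smul_Complex) (simp add: lin)
    from this[of c] this[of "\<i> * c"] show ?thesis by (simp add: complex_eq_iff)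
  qed
  ultimately show ?thesis by (simp add: cdual_def)
qed

section \<open>Separation of points by complex functionals\<close>

lemma exists_dual:
  assumes "y \<noteq> 0" obtains f where "f \<in> dual" "f y = 1"
proof -
  obtain \<rho> :: "'a \<Rightarrow> real" where \<rho>: "bounded_linear \<rho>" "\<rho> y = norm y"
    by (rule exists_norming_functional[of y]) blast
  let ?f = "\<lambda>u. Complex (\<rho> u) (- \<rho> (smul \<i> u))"
  have f: "?f \<in> dual" "?f y \<noteq> 0"
    using complexification_in_dual[OF \<rho>(1)] \<rho>(2) assms by (auto simp: complex_eq_iff)
  show ?thesis by (rule that[of "\<lambda>u. (1 / ?f y) * ?f u"], rule dual_scale) (use f in auto)
qed

lemma dual_separates: "(\<And>f. f \<in> dual \<Longrightarrow> f x = f y) \<Longrightarrow> x = y"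
  using exists_dual[of "x - y"] by (metis dualD(5) eq_iff_diff_eq_0 zero_neq_one)

text \<open>Take one functional for y and one for w: either one of them works after rescaling, or
  each vanishes at the other's vector and their sum works.\<close>

lemma exists_dual_nonzero2:
  assumes "y \<noteq> 0" "w \<noteq> 0" obtains f where "f \<in> dual" "f y = 1" "f w \<noteq> 0"
proof -
  obtain f1 where f1: "f1 \<in> dual" "f1 y = 1" using exists_dual[OF assms(1)] by blast
  obtain f2 where f2: "f2 \<in> dual" "f2 w = 1" using exists_dual[OF assms(2)] by blast
  consider "f1 w \<noteq> 0" | "f1 w = 0" "f2 y = 0" | "f2 y \<noteq> 0" by blast
  thus ?thesis
  proof cases
    case 1 thus ?thesis using that f1 by blast
  next
    case 2 show ?thesis by (rule that[of "\<lambda>x. f1 x + f2 x"]) (use f1 f2 2 in auto)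
  next
    case 3 show ?thesis by (rule that[of "\<lambda>x. (1 / f2 y) * f2 x"], rule dual_scale) (use f2 3 in auto)
  qed
qed

lemma exists_dual_pair:
  assumes "a \<noteq> 0" "\<And>t. c \<noteq> smul t a"
  obtains \<alpha> \<gamma> where "\<alpha> \<in> dual" "\<gamma> \<in> dual" "\<alpha> a = 1" "\<alpha> c = 0" "\<gamma> a = 0" "\<gamma> c = 1"
proof -
  obtain h where h: "h \<in> dual" "h a = 1" using exists_dual[OF assms(1)] by blast
  have "c - smul (h c) a \<noteq> 0" using assms(2)[of "h c"] by simp
  then obtain k where k: "k \<in> dual" "k (c - smul (h c) a) = 1" using exists_dual by blast
  define \<gamma> where "\<gamma> = (\<lambda>x. k x - k a * h x)"
  have "\<gamma> \<in> dual" unfolding \<gamma>_def using h k by (intro dual_diff dual_scale)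
  moreover have "\<gamma> a = 0" "\<gamma> c = 1" using h k by (auto simp: \<gamma>_def dualD algebra_simps)
  ultimately show ?thesis by (intro that[of "\<lambda>x. h x - h c * \<gamma> x" \<gamma>] dual_diff dual_scale) (use h in auto)
qed

text \<open>Tests with \<open>g y = 1\<close> correspond to rank one idempotents
  \<open>y \<odot> g\<close>, for which the powers of \<open>g y\<close> in the trace formulas
  disappear.\<close>

lemma bop_eqI:
  assumes Z: "bop Z" "bop Z'" and eq: "\<And>y g. g \<in> dual \<Longrightarrow> g y = 1 \<Longrightarrow> g (Z y) = g (Z' y)"
  shows "Z = Z'"
proof (rule ext, rule ccontr)
  fix y assume "Z y \<noteq> Z' y"
  moreover have "y \<noteq> 0" using \<open>Z y \<noteq> Z' y\<close> bopD(4)[OF Z(1)] bopD(4)[OF Z(2)] by auto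
  ultimately obtain g where "g \<in> dual" "g y = 1" "g (Z y - Z' y) \<noteq> 0"
    using exists_dual_nonzero2[of y "Z y - Z' y"] by auto
  thus False using eq by (simp add: dualD)
qed

section \<open>The operators \<open>x \<odot> f\<close>, their rank and their trace\<close>

definition tensor :: "'a \<Rightarrow> ('a \<Rightarrow> complex) \<Rightarrow> 'a \<Rightarrow> 'a" (infix "\<odot>" 80) where
  "x \<odot> f = (\<lambda>u. smul (f u) x)"

lemma tensor_apply: "(x \<odot> f) u = smul (f u) x"
  by (simp add: tensor_def)

lemma bop_tensor [intro]: "f \<in> dual \<Longrightarrow> bop (x \<odot> f)"
proof -
  assume f: "f \<in> dual"
  have "bounded_linear f" by (rule dualD[OF f])
  then obtain K where K: "\<And>u. norm (f u) \<le> norm u * K" using bounded_linear.bounded by blast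
  have "bounded_linear (\<lambda>u. smul (f u) x)"
  proof (rule bounded_linear_intro[where K = "K * norm x"])
    fix u r
    show "norm (smul (f u) x) \<le> norm u * (K * norm x)"
      using mult_right_mono[OF K[of u] norm_ge_zero[of x]] by (simp add: mult.assoc)
    have "f (r *\<^sub>R u) = complex_of_real r * f u"
      using dualD(3)[OF f, of "complex_of_real r" u] by (simp add: smul_of_real)
    thus "smul (f (r *\<^sub>R u)) x = r *\<^sub>R smul (f u) x"
      by (simp add: smul_of_real[symmetric])
  qed (simp add: dualD[OF f] cv.scale_left_distrib)
  thus ?thesis by (simp add: bounded_clinear_op_def tensor_def dualD[OF f])
qed

lemma tensor_add_left: "(x + y) \<odot> f = (\<lambda>u. (x \<odot> f) u + (y \<odot> f) u)"
  by (simp add: tensor_def cv.scale_right_distrib)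

lemma tensor_add_right: "x \<odot> (\<lambda>u. f u + g u) = (\<lambda>u. (x \<odot> f) u + (x \<odot> g) u)"
  by (simp add: tensor_def cv.scale_left_distrib)

lemma tensor_scale_left: "smul c x \<odot> f = (\<lambda>u. smul c ((x \<odot> f) u))"
  by (simp add: tensor_def mult.commute)

lemma tensor_scale_right: "x \<odot> (\<lambda>u. c * f u) = (\<lambda>u. smul c ((x \<odot> f) u))"
  by (simp add: tensor_def)

text \<open>The zero operator is included, so this means rank at most one.\<close>

definition rank_one :: "('a \<Rightarrow> 'a) \<Rightarrow> bool" where
  "rank_one T \<longleftrightarrow> (\<exists>x f. f \<in> dual \<and> T = x \<odot> f)"

lemma rank_one_tensor: "f \<in> dual \<Longrightarrow> rank_one (x \<odot> f)"
  by (auto simp: rank_one_def)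

lemma rank_le_tensor: "rank_le smul (x \<odot> f) 1"
proof -
  have "(x \<odot> f) u \<in> cspan_list smul [x]" for u
    unfolding cspan_list_def tensor_def by (auto intro!: exI[of _ "\<lambda>_. f u"])
  thus ?thesis unfolding rank_le_def by (intro exI[of _ "[x]"]) auto
qed

lemma rank_le_tensor2: "rank_le smul (\<lambda>u. (x \<odot> f) u + (y \<odot> g) u) 2"
proof -
  have "(x \<odot> f) u + (y \<odot> g) u \<in> cspan_list smul [x, y]" for u
    unfolding cspan_list_def tensor_def
    by (auto intro!: exI[of _ "\<lambda>i. if i = 0 then f u else g u"] simp: lessThan_Suc)
  thus ?thesis unfolding rank_le_def by (intro exI[of _ "[x, y]"]) auto
qed

lemma rank_le_tensor3: "rank_le smul (\<lambda>u. (x \<odot> f) u + (y \<odot> g) u + (z \<odot> h) u) 3"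
proof -
  have "(x \<odot> f) u + (y \<odot> g) u + (z \<odot> h) u \<in> cspan_list smul [x, y, z]" for u
    unfolding cspan_list_def tensor_def
    by (auto intro!: exI[of _ "\<lambda>i. if i = 0 then f u else if i = 1 then g u else h u"]
        simp: lessThan_Suc algebra_simps)
  thus ?thesis unfolding rank_le_def by (intro exI[of _ "[x, y, z]"]) auto
qed

lemma rank_le_mono: "rank_le smul T j \<Longrightarrow> j \<le> l \<Longrightarrow> rank_le smul T l"
  unfolding rank_le_def by (meson order_trans)

text \<open>Well-definedness of the trace of finite rank operators, via coordinates in a Hamel basis.\<close>

lemma trace_zero:
  assumes I: "finite I" and f: "\<And>i. i \<in> I \<Longrightarrow> f i \<in> dual"
    and zero: "\<And>u. (\<Sum>i\<in>I. (x i \<odot> f i) u) = 0"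
  shows "(\<Sum>i\<in>I. f i (x i)) = 0"
proof -
  define B where "B = cv.extend_basis {}"
  have B: "cv.independent B" "cv.span B = UNIV"
    unfolding B_def by (simp_all add: cv.independent_extend_basis cv.span_extend_basis cv.independent_empty)
  let ?r = "cv.representation B"
  \<comment> \<open>K collects the finitely many basis vectors that occur in some
    \<open>x i\<close>; after exchanging the sums, the trace is the sum over K of the diagonal
    matrix entries of the zero operator.\<close>
  define K where "K = (\<Union>i\<in>I. {b. ?r (x i) b \<noteq> 0})"
  have K: "finite K" using I cv.finite_representation by (auto simp: K_def)
  have "f i (x i) = (\<Sum>b\<in>K. ?r (x i) b * f i b)" if i: "i \<in> I" for i
  proof -
    interpret fi: Vector_Spaces.linear smul "(*)" "f i"
      by unfold_locales (auto simp: dualD[OF f[OF i]] algebra_simps)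
    have "x i = (\<Sum>b | ?r (x i) b \<noteq> 0. smul (?r (x i) b) b)"
      using cv.sum_nonzero_representation_eq[OF B(1), of "x i"] B(2) by simp
    also have "\<dots> = (\<Sum>b\<in>K. smul (?r (x i) b) b)"
      by (rule sum.mono_neutral_left) (use K i in \<open>auto simp: K_def\<close>)
    finally have "f i (x i) = f i (\<Sum>b\<in>K. smul (?r (x i) b) b)" by simp
    thus ?thesis by (simp add: fi.sum fi.scale)
  qed
  hence "(\<Sum>i\<in>I. f i (x i)) = (\<Sum>i\<in>I. \<Sum>b\<in>K. ?r (x i) b * f i b)" by simp
  also have "\<dots> = (\<Sum>b\<in>K. \<Sum>i\<in>I. f i b * ?r (x i) b)"
    by (subst sum.swap) (simp add: mult.commute)
  also have "\<dots> = (\<Sum>b\<in>K. ?r (\<Sum>i\<in>I. (x i \<odot> f i) b) b)"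
    using B by (simp add: cv.representation_sum cv.representation_scale tensor_def)
  finally show ?thesis by (simp add: zero cv.representation_zero)
qed

text \<open>Two summands are what the two halves of a Jordan product give. With the right side moved
  over, four tensors sum to zero.\<close>

lemma trace_unique2:
  assumes "f1 \<in> dual" "f2 \<in> dual" "f3 \<in> dual" "f4 \<in> dual"
    and eq: "\<And>u. (x1 \<odot> f1) u + (x2 \<odot> f2) u = (x3 \<odot> f3) u + (x4 \<odot> f4) u"
  shows "f1 x1 + f2 x2 = f3 x3 + f4 x4"
proof -
  let ?f = "\<lambda>i. [f1, f2, f3, f4] ! i" and ?x = "\<lambda>i. [x1, x2, - x3, - x4] ! i"
  have "(\<Sum>i<4. (?x i \<odot> ?f i) u) = 0" for u
    using eq[of u] by (simp add: eval_nat_numeral tensor_def)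
  moreover have "?f i \<in> dual" if "i < 4" for i
    using that assms(1-4) by (auto simp: less_Suc_eq eval_nat_numeral)
  ultimately have "(\<Sum>i<4. ?f i (?x i)) = 0" by (intro trace_zero) auto
  thus ?thesis using assms(3,4) by (simp add: eval_nat_numeral dualD algebra_simps)
qed

lemma trace_unique:
  assumes "f \<in> dual" "g \<in> dual" "x \<odot> f = y \<odot> g"
  shows "f x = g y"
  using trace_unique2[of f "\<lambda>_. 0" g "\<lambda>_. 0" x 0 y 0] assms by (simp add: tensor_def fun_eq_iff)

text \<open>If c is not a multiple of a, functionals biorthogonal to a and c read off b and d as
  multiples of the single functional h, so d is a multiple of the nonzero b. This is the basic tool
  for deciding whether rank one operators share their range or their kernel.\<close>

lemma tensor_add_dichotomy:
  assumes d: "b \<in> dual" "d \<in> dual" "h \<in> dual" and b: "b p \<noteq> 0" and a: "a \<noteq> 0"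
    and eq: "\<And>u. (a \<odot> b) u + (c \<odot> d) u = (e \<odot> h) u"
  shows "(\<exists>t. c = smul t a) \<or> (\<exists>t. d = (\<lambda>u. t * b u))"
proof (rule disjCI)
  assume "\<nexists>t. d = (\<lambda>u. t * b u)"
  show "\<exists>t. c = smul t a"
  proof (rule ccontr)
    assume "\<nexists>t. c = smul t a"
    then obtain \<alpha> \<gamma> where \<alpha>: "\<alpha> \<in> dual" "\<gamma> \<in> dual" "\<alpha> a = 1" "\<alpha> c = 0" "\<gamma> a = 0" "\<gamma> c = 1"
      using exists_dual_pair[OF a, of c] by metis
    have "\<alpha> ((a \<odot> b) u + (c \<odot> d) u) = \<alpha> ((e \<odot> h) u)" "\<gamma> ((a \<odot> b) u + (c \<odot> d) u) = \<gamma> ((e \<odot> h) u)" for u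
      using eq by auto
    hence 1: "b u = h u * \<alpha> e" and 2: "d u = h u * \<gamma> e" for u
      using \<alpha> by (auto simp: tensor_def dualD)
    have "\<alpha> e \<noteq> 0" using 1[of p] b by auto
    hence "d = (\<lambda>u. (\<gamma> e / \<alpha> e) * b u)" using 1 2 by auto
    thus False using \<open>\<nexists>t. d = (\<lambda>u. t * b u)\<close> by blast
  qed
qed

end

section \<open>Jordan automorphisms on rank one operators\<close>

text \<open>\<open>\<zeta>\<close> is a root of -1 of order \<open>|r - s|\<close>. It becomes the
  eigenvalue of a test operator for the symmetrized product.\<close>

lemma exists_opposite_powers:
  assumes "r \<noteq> (s::nat)" obtains \<zeta> :: complex where "\<zeta> \<noteq> 0" "\<zeta> ^ r + \<zeta> ^ s = 0"
proof -
  have "\<exists>\<zeta>::complex. \<zeta> \<noteq> 0 \<and> \<zeta> ^ r + \<zeta> ^ s = 0" if "r < s" for r s :: nat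
  proof -
    define \<zeta> where "\<zeta> = cis (pi / real (s - r))"
    have "real (s - r) * (pi / real (s - r)) = pi" using that by simp
    hence "\<zeta> ^ (s - r) = -1" by (simp only: \<zeta>_def Complex.DeMoivre cis_pi)
    moreover have "\<zeta> ^ s = \<zeta> ^ r * \<zeta> ^ (s - r)" using that by (simp flip: power_add)
    moreover have "\<zeta> \<noteq> 0" by (simp add: \<zeta>_def)
    ultimately have "\<zeta> ^ r + \<zeta> ^ s = \<zeta> ^ r + \<zeta> ^ r * -1" by (simp only:)
    with \<open>\<zeta> \<noteq> 0\<close> show ?thesis by (intro exI[of _ \<zeta>]) simp
  qed
  from this[of r s] this[of s r] assms show ?thesis
    by (metis that add.commute nat_neq_iff)
qed

text \<open>The left sides are the entries of a 3x2 matrix times a 2x3 matrix, which has determinant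
  zero; the right sides say that this product is diagonal.\<close>

lemma det3_rank_two:
  fixes p1 :: "'b::comm_ring_1"
  assumes "p1 * s1 + q1 * t1 = l1" "p1 * s2 + q1 * t2 = 0" "p1 * s3 + q1 * t3 = 0"
    "p2 * s1 + q2 * t1 = 0" "p2 * s2 + q2 * t2 = l2" "p2 * s3 + q2 * t3 = 0"
    "p3 * s1 + q3 * t1 = 0" "p3 * s2 + q3 * t2 = 0" "p3 * s3 + q3 * t3 = l3"
  shows "l1 * l2 * l3 = 0"
proof -
  define m where "m p q s t = p * s + q * t" for p q s t :: 'b
  have "m p1 q1 s1 t1 * (m p2 q2 s2 t2 * m p3 q3 s3 t3 - m p2 q2 s3 t3 * m p3 q3 s2 t2)
      - m p1 q1 s2 t2 * (m p2 q2 s1 t1 * m p3 q3 s3 t3 - m p2 q2 s3 t3 * m p3 q3 s1 t1)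
      + m p1 q1 s3 t3 * (m p2 q2 s1 t1 * m p3 q3 s2 t2 - m p2 q2 s2 t2 * m p3 q3 s1 t1) = 0"
    unfolding m_def by (simp add: algebra_simps)
  thus ?thesis using assms by (simp add: m_def mult.assoc)
qed

section \<open>Powers and sandwiched products of rank one operators\<close>

context complex_banach
begin

lemma double_cancel: "v + v = w + w \<Longrightarrow> v = (w::'a)"
  by (metis scaleR_2 scaleR_cancel_left zero_neq_numeral)

lemma funpow_eigenvector: "bop U \<Longrightarrow> U v = smul c v \<Longrightarrow> (U ^^ j) v = smul (c ^ j) v"
  by (induction j) (auto simp: bopD mult.commute)

lemma tensor_power: "b \<in> dual \<Longrightarrow> ((a \<odot> b) ^^ Suc j) u = smul (b a ^ j * b u) a"
  by (induction j) (auto simp: tensor_def dualD algebra_simps)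

text \<open>With R = \<open>a \<odot> b\<close> this is cyclicity,
  \<open>tr (R^r Z R^s) = tr (R^(n+1) Z)\<close>, together with \<open>R^(n+1) = (b a)^n R\<close>.
  The cases arise because a zeroth power is the identity and leaves Z exposed on that side.\<close>

lemma tensor_sandwich:
  assumes b: "b \<in> dual" and Z: "bop Z" and rs: "r + s = Suc n"
  obtains c d where "d \<in> dual" "(a \<odot> b) ^^ r \<circ> Z \<circ> (a \<odot> b) ^^ s = c \<odot> d" "d c = b a ^ n * b (Z a)"
proof (cases r)
  case 0
  show ?thesis
  proof (rule that[of b "smul (b a ^ n) (Z a)"])
    show "(a \<odot> b) ^^ r \<circ> Z \<circ> (a \<odot> b) ^^ s = smul (b a ^ n) (Z a) \<odot> b"
    proof
      fix u
      have "s = Suc n" using 0 rs by simp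
      thus "((a \<odot> b) ^^ r \<circ> Z \<circ> (a \<odot> b) ^^ s) u = (smul (b a ^ n) (Z a) \<odot> b) u"
        using 0 Z by (simp add: tensor_power[OF b] tensor_apply bopD mult.commute del: funpow.simps(2))
    qed
  qed (use b in \<open>auto simp: dualD\<close>)
next
  case (Suc r')
  show ?thesis
  proof (cases s)
    case 0
    show ?thesis
    proof (rule that[of "\<lambda>u. b (Z u)" "smul (b a ^ n) a"])
      show "(a \<odot> b) ^^ r \<circ> Z \<circ> (a \<odot> b) ^^ s = smul (b a ^ n) a \<odot> (\<lambda>u. b (Z u))"
      proof
        fix u
        have "r = Suc n" using 0 rs by simp
        thus "((a \<odot> b) ^^ r \<circ> Z \<circ> (a \<odot> b) ^^ s) u = (smul (b a ^ n) a \<odot> (\<lambda>u. b (Z u))) u"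
          using 0 by (simp add: tensor_power[OF b] tensor_apply mult.commute del: funpow.simps(2))
      qed
    qed (use b Z in \<open>auto simp: dualD bopD dual_comp\<close>)
  next
    case (Suc s')
    note s = this
    have n: "n = Suc (r' + s')" using rs \<open>r = Suc r'\<close> s by simp
    show ?thesis
    proof (rule that[of b "smul (b a ^ (r' + s') * b (Z a)) a"])
      show "(a \<odot> b) ^^ r \<circ> Z \<circ> (a \<odot> b) ^^ s = smul (b a ^ (r' + s') * b (Z a)) a \<odot> b"
        unfolding \<open>r = Suc r'\<close> s using Z b
        by (simp add: fun_eq_iff tensor_power[OF b] tensor_apply bopD dualD power_add mult_ac del: funpow.simps)
    qed (use b n in \<open>auto simp: dualD power_add\<close>)
  qed
qed

text \<open>The counterpart of \<open>tensor_sandwich\<close> with the rank one factor in the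
  middle: the left power acts on x, the right one on f.\<close>

lemma sandwiched_tensor:
  assumes f: "f \<in> dual" and A: "bop A"
  obtains c d where "d \<in> dual" "A ^^ r \<circ> (x \<odot> f) \<circ> A ^^ s = c \<odot> d" "d c = f ((A ^^ (r + s)) x)"
proof (rule that[of "\<lambda>u. f ((A ^^ s) u)" "(A ^^ r) x"])
  show "(\<lambda>u. f ((A ^^ s) u)) \<in> dual" using dual_comp[OF f bop_funpow[OF A]] .
  show "A ^^ r \<circ> (x \<odot> f) \<circ> A ^^ s = (A ^^ r) x \<odot> (\<lambda>u. f ((A ^^ s) u))"
    using bopD(3)[OF bop_funpow[OF A]] by (auto simp: fun_eq_iff tensor_apply)
  show "f ((A ^^ s) ((A ^^ r) x)) = f ((A ^^ (r + s)) x)"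
    by (metis add.commute comp_apply funpow_add)
qed

text \<open>In the second case the nilpotent part of T is nonzero and has a Jordan block spanned by y and z.\<close>

lemma root_of_rank_one_idempotent:
  assumes T: "bop T" and f: "f \<in> dual" and fx: "f x = 1" and pow: "T ^^ Suc j = x \<odot> f"
  obtains (rank_one) \<xi> where "T = smul \<xi> x \<odot> f"
  | (block) \<xi> y z g h where "\<xi> \<noteq> 0" "T x = smul \<xi> x" "T z = y" "T y = 0" "f y = 0" "f z = 0"
      "h \<in> dual" "h x = 0" "h y = 1" "h z = 0" "g \<in> dual" "g x = 0" "g y = 0" "g z = 1"
proof -
  \<comment> \<open>T commutes with its power \<open>x \<odot> f\<close>. Hence x is an eigenvector
    of T and f one of its adjoint, with the same eigenvalue \<open>\<xi>\<close>.\<close>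
  have comm: "T (smul (f u) x) = smul (f (T u)) x" for u
  proof -
    have "T ((T ^^ Suc j) u) = (T ^^ Suc j) (T u)" by (simp add: funpow_swap1)
    thus ?thesis unfolding pow by (simp add: tensor_apply)
  qed
  define \<xi> where "\<xi> = f (T x)"
  have Tx: "T x = smul \<xi> x" using comm[of x] fx by (simp add: \<xi>_def)
  have x0: "x \<noteq> 0" using fx f dualD(4) by fastforce
  have "smul (\<xi> ^ Suc j) x = x"
    using funpow_eigenvector[OF T Tx, of "Suc j"] fx unfolding pow by (simp add: tensor_apply)
  hence "\<xi> ^ Suc j = 1" using smul_left_eqD[of "\<xi> ^ Suc j" x 1] x0 by simp
  hence \<xi>0: "\<xi> \<noteq> 0" by auto
  have fT: "f (T u) = \<xi> * f u" for u
    using comm[of u] Tx x0 T by (simp add: bopD mult.commute)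
  show ?thesis
  \<comment> \<open>T respects the splitting into the span of x and the kernel of f, and is
    nilpotent on that kernel; the cases are a zero and a nonzero nilpotent part.\<close>
  proof (cases "\<forall>w. f w = 0 \<longrightarrow> T w = 0")
    case True
    have "T u = (smul \<xi> x \<odot> f) u" for u
    proof -
      have "T (u - smul (f u) x) = 0" using True f fx by (simp add: dualD)
      thus ?thesis using T Tx by (simp add: bopD tensor_apply mult.commute)
    qed
    hence "T = smul \<xi> x \<odot> f" by blast
    thus ?thesis by (rule rank_one)
  next
    case False
    then obtain w where w: "f w = 0" "T w \<noteq> 0" by blast
    have fTw: "f ((T ^^ i) w) = 0" for i by (induction i) (auto simp: w fT)
    \<comment> \<open>i is the length of the chain w, T w, ... before it reaches zero. It is at
      least two, and the last two nonzero members become z0 and y.\<close>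
    define i where "i = (LEAST i. (T ^^ i) w = 0)"
    have "(T ^^ Suc j) w = 0" unfolding pow by (simp add: tensor_apply w)
    hence i0: "(T ^^ i) w = 0" unfolding i_def by (rule LeastI)
    have least: "(T ^^ l) w \<noteq> 0" if "l < i" for l using not_less_Least that unfolding i_def by blast
    have "(T ^^ 0) w \<noteq> 0" "(T ^^ 1) w \<noteq> 0" using w(2) T by (auto simp: bopD)
    hence "i \<noteq> 0" "i \<noteq> 1" using i0 by metis+
    then obtain l where l: "i = Suc (Suc l)" by (metis One_nat_def nat.exhaust)
    define y z0 where "y = (T ^^ Suc l) w" and "z0 = (T ^^ l) w"
    have y: "y \<noteq> 0" "T y = 0" "T z0 = y" "f y = 0" "f z0 = 0"
      using least[of "Suc l"] i0 l fTw[of l] fTw[of "Suc l"] by (auto simp: y_def z0_def)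
    obtain h0 where h0: "h0 \<in> dual" "h0 y = 1" using exists_dual[OF y(1)] by blast
    \<comment> \<open>The correction makes \<open>h0 z\<close> vanish and does not change T z,
      because T y = 0.\<close>
    define z where "z = z0 - smul (h0 z0) y"
    have z: "T z = y" "f z = 0" "h0 z = 0"
      using y h0 T f by (auto simp: z_def bopD dualD)
    have "z \<noteq> 0" using z y T by (auto simp: bopD)
    then obtain g0 where g0: "g0 \<in> dual" "g0 z = 1" using exists_dual by blast
    define g1 where "g1 = (\<lambda>u. g0 u - g0 y * h0 u)"
    have g1: "g1 \<in> dual" "g1 z = 1" "g1 y = 0"
      unfolding g1_def using g0 h0 z by (auto intro!: dual_diff dual_scale)
    show ?thesis
    proof (rule block[OF \<xi>0 Tx z(1) y(2) y(4) z(2)])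
      \<comment> \<open>Subtracting multiples of f makes both functionals vanish at x; their values
        at y and z stay, since f vanishes there.\<close>
      show "(\<lambda>u. h0 u - h0 x * f u) \<in> dual" "(\<lambda>u. g1 u - g1 x * f u) \<in> dual"
        using h0 f g1 by (auto intro!: dual_diff dual_scale)
    qed (use h0 g1 z y fx in auto)
  qed
qed

end

section \<open>Jordan automorphisms of a standard operator algebra\<close>

locale standard_algebra = complex_banach smul
  for smul :: "complex \<Rightarrow> 'a::banach \<Rightarrow> 'a" +
  fixes \<A> :: "('a \<Rightarrow> 'a) set"
  assumes soa: "standard_operator_algebra smul \<A>"
begin

lemma A_bop: "T \<in> \<A> \<Longrightarrow> bop T"
  and A_add: "S \<in> \<A> \<Longrightarrow> T \<in> \<A> \<Longrightarrow> (\<lambda>x. S x + T x) \<in> \<A>"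
  and A_comp: "S \<in> \<A> \<Longrightarrow> T \<in> \<A> \<Longrightarrow> S \<circ> T \<in> \<A>"
  and A_scale: "T \<in> \<A> \<Longrightarrow> (\<lambda>x. smul c (T x)) \<in> \<A>"
  using soa by (auto simp: standard_operator_algebra_def)

lemma A_tensor:
  assumes "f \<in> dual" shows "x \<odot> f \<in> \<A>"
proof -
  have "x \<odot> f \<in> {T. bop T \<and> finite_rank smul T}"
    using bop_tensor[OF assms] rank_le_tensor by (auto simp: finite_rank_def)
  thus ?thesis using soa unfolding standard_operator_algebra_def by (elim conjE) (rule subsetD)
qed

lemma A_sandwich: "A \<in> \<A> \<Longrightarrow> B \<in> \<A> \<Longrightarrow> A ^^ r \<circ> B \<circ> A ^^ s \<in> \<A>"
proof (induction r)
  case 0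
  have "B \<circ> A ^^ s \<in> \<A>"
  proof (induction s)
    case (Suc s)
    have "B \<circ> A ^^ Suc s = (B \<circ> A ^^ s) \<circ> A" by (simp add: funpow_Suc_right comp_assoc del: funpow.simps)
    thus ?case using A_comp[OF Suc 0(1)] by (simp only:)
  qed (use 0 in simp)
  thus ?case by (simp add: comp_def)
next
  case (Suc r)
  have "A ^^ Suc r \<circ> B \<circ> A ^^ s = A \<circ> (A ^^ r \<circ> B \<circ> A ^^ s)" by (simp add: comp_assoc)
  thus ?case using A_comp[OF Suc(2) Suc(1)] Suc by metis
qed

abbreviation jordan :: "(('a \<Rightarrow> 'a) \<Rightarrow> 'a \<Rightarrow> 'a) \<Rightarrow> bool" where
  "jordan \<equiv> jordan_automorphism smul \<A>"

lemma jordanD: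
  assumes "jordan \<theta>"
  shows "bij_betw \<theta> \<A> \<A>"
    "S \<in> \<A> \<Longrightarrow> T \<in> \<A> \<Longrightarrow> \<theta> (\<lambda>x. S x + T x) = (\<lambda>x. \<theta> S x + \<theta> T x)"
    "T \<in> \<A> \<Longrightarrow> \<theta> (\<lambda>x. smul c (T x)) = (\<lambda>x. smul c (\<theta> T x))"
    "S \<in> \<A> \<Longrightarrow> T \<in> \<A> \<Longrightarrow> \<theta> (\<lambda>x. S (T x) + T (S x)) = (\<lambda>x. \<theta> S (\<theta> T x) + \<theta> T (\<theta> S x))"
  using assms by (auto simp: jordan_automorphism_def alg_linear_bij_def)

text \<open>This lets the ordinary product be treated with results on Jordan automorphisms
  alone.\<close>

lemma algebra_automorphism_jordan:
  assumes "algebra_automorphism smul \<A> \<theta>" shows "jordan \<theta>"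
  unfolding jordan_automorphism_def
proof (intro conjI ballI)
  show lin: "alg_linear_bij smul \<A> \<theta>" using assms by (simp add: algebra_automorphism_def)
  fix S T assume ST: "S \<in> \<A>" "T \<in> \<A>"
  have "\<theta> (\<lambda>x. (S \<circ> T) x + (T \<circ> S) x) = (\<lambda>x. \<theta> (S \<circ> T) x + \<theta> (T \<circ> S) x)"
    using lin A_comp ST unfolding alg_linear_bij_def by blast
  moreover have "\<theta> (S \<circ> T) = \<theta> S \<circ> \<theta> T" "\<theta> (T \<circ> S) = \<theta> T \<circ> \<theta> S"
    using assms ST by (auto simp: algebra_automorphism_def)
  ultimately show "\<theta> (\<lambda>x. S (T x) + T (S x)) = (\<lambda>x. \<theta> S (\<theta> T x) + \<theta> T (\<theta> S x))"
    by simp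
qed

text \<open>With R of rank one, RAR is a multiple of R, and a Jordan automorphism respects such triple products;
  an operator T with TBT a multiple of T for all B in the algebra has rank at most one.\<close>

lemma jordan_tensor:
  assumes \<theta>: "jordan \<theta>" and f: "f \<in> dual"
  obtains a b where "b \<in> dual" "\<theta> (x \<odot> f) = a \<odot> b" "b a = f x"
proof -
  define R T where "R = x \<odot> f" and "T = \<theta> R"
  have RA: "R \<in> \<A>" using A_tensor f by (simp add: R_def)
  have TA: "T \<in> \<A>" using jordanD(1)[OF \<theta>] RA by (auto simp: T_def bij_betw_def)
  have R: "bop R" and T: "bop T" using RA TA A_bop by auto
  have RR: "R (R u) = smul (f x) (R u)" for u
    using f by (simp add: R_def tensor_apply dualD)
  have TT: "T (T u) = smul (f x) (T u)" for u
  proof (rule double_cancel)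
    have "(\<lambda>x. T (T x) + T (T x)) = \<theta> (\<lambda>x. R (R x) + R (R x))"
      using jordanD(4)[OF \<theta> RA RA] by (simp add: T_def)
    also have "(\<lambda>x. R (R x) + R (R x)) = (\<lambda>u. smul (2 * f x) (R u))"
      by (simp add: RR cv.scale_left_distrib[symmetric])
    also have "\<theta> \<dots> = (\<lambda>u. smul (2 * f x) (T u))" by (simp add: jordanD(3)[OF \<theta> RA] T_def)
    finally show "T (T u) + T (T u) = smul (f x) (T u) + smul (f x) (T u)"
      by (simp add: fun_eq_iff cv.scale_left_distrib[symmetric])
  qed
  have TBT: "T (B (T u)) = smul (f (inv_into \<A> \<theta> B x)) (T u)" if B: "B \<in> \<A>" for B u
  proof -
    define A where "A = inv_into \<A> \<theta> B"
    have A: "A \<in> \<A>" "\<theta> A = B"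
      unfolding A_def using bij_betw_imp_surj_on[OF jordanD(1)[OF \<theta>]] B
      by (metis inv_into_into, metis f_inv_into_f)
    have Ab: "bop A" and Bb: "bop B" using A B A_bop by auto
    \<comment> \<open>The anticommutator of R and A extracts RAR by Jordan products alone: as RR is
      \<open>f x\<close> times R, the anticommutator of R and K is
      \<open>2 RAR + f x K\<close>.\<close>
    define K where "K = (\<lambda>u. R (A u) + A (R u))"
    have K: "K \<in> \<A>" using A_add[OF A_comp[OF RA A(1)] A_comp[OF A(1) RA]] by (simp add: K_def)
    have \<theta>K: "\<theta> K = (\<lambda>u. T (B u) + B (T u))"
      unfolding K_def using jordanD(4)[OF \<theta> RA A(1)] A(2) by (simp add: T_def)
    have RAR: "R (A (R u)) = smul (f (A x)) (R u)" for u
      using f Ab by (simp add: R_def tensor_apply dualD bopD mult.commute)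
    have eq: "(\<lambda>u. R (K u) + K (R u)) = (\<lambda>u. smul (2 * f (A x)) (R u) + smul (f x) (K u))"
    proof
      fix u
      have "R (K u) + K (R u) = R (R (A u)) + R (A (R u)) + (R (A (R u)) + A (R (R u)))"
        using R by (simp add: K_def bopD)
      also have "\<dots> = smul (f x) (K u) + (smul (f (A x)) (R u) + smul (f (A x)) (R u))"
        using Ab by (simp only: RAR RR) (simp add: K_def bopD cv.scale_right_distrib)
      finally show "R (K u) + K (R u) = smul (2 * f (A x)) (R u) + smul (f x) (K u)"
        by (simp add: cv.scale_left_distrib[symmetric])
    qed
    have "T (B (T u)) = smul (f (A x)) (T u)"
    proof (rule double_cancel)
      have "(\<lambda>u. T (\<theta> K u) + \<theta> K (T u)) = \<theta> (\<lambda>u. R (K u) + K (R u))"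
        using jordanD(4)[OF \<theta> RA K] by (simp add: T_def)
      also have "\<dots> = (\<lambda>u. smul (2 * f (A x)) (T u) + smul (f x) (\<theta> K u))"
        unfolding eq using jordanD(2)[OF \<theta> A_scale[OF RA] A_scale[OF K]] jordanD(3)[OF \<theta>] RA K
        by (simp add: T_def)
      finally have "T (\<theta> K u) + \<theta> K (T u) = smul (2 * f (A x)) (T u) + smul (f x) (\<theta> K u)"
        by (rule fun_cong)
      moreover have "T (\<theta> K u) + \<theta> K (T u) = smul (f x) (\<theta> K u) + (T (B (T u)) + T (B (T u)))"
        using T Bb by (simp add: \<theta>K bopD TT cv.scale_right_distrib)
      ultimately show "T (B (T u)) + T (B (T u)) = smul (f (A x)) (T u) + smul (f (A x)) (T u)"
        by (simp add: cv.scale_left_distrib[symmetric])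
    qed
    thus ?thesis by (simp add: A_def)
  qed
  show ?thesis
  proof (cases "\<exists>z. T z \<noteq> 0")
    case False
    have "\<theta> (\<lambda>u. smul 0 (R u)) = (\<lambda>u. smul 0 (T u))" unfolding T_def by (rule jordanD(3)[OF \<theta> RA])
    hence "\<theta> (\<lambda>u. 0) = \<theta> R" using False by (auto simp: T_def[symmetric])
    moreover have "(\<lambda>u. 0) \<in> \<A>" using A_scale[OF RA, of 0] by simp
    ultimately have "R = (\<lambda>u. 0)" using jordanD(1)[OF \<theta>] RA by (auto simp: bij_betw_def inj_on_def)
    hence "R x = 0" by simp
    hence "f x = 0" using f by (auto simp: R_def tensor_apply dualD)
    moreover have "\<theta> (x \<odot> f) = 0 \<odot> (\<lambda>_. 0)"
      using False unfolding T_def R_def by (simp add: tensor_def fun_eq_iff)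
    ultimately show ?thesis using that[OF dual_zero] by simp
  next
    case True
    then obtain z where z: "T z \<noteq> 0" by blast
    obtain h where h: "h \<in> dual" "h (T z) = 1" by (rule exists_dual[OF z])
    \<comment> \<open>B = \<open>u \<odot> h\<close> sends T z to u, so TBT z = T u, and by
      \<open>TBT\<close> this is a multiple of T z. Thus the range of T is spanned by T z.\<close>
    have Tu: "T u = smul (h (T u)) (T z)" for u
    proof -
      define t where "t = f (inv_into \<A> \<theta> (u \<odot> h) x)"
      have "T ((u \<odot> h) (T z)) = smul t (T z)" unfolding t_def by (rule TBT[OF A_tensor[OF h(1)]])
      hence "T u = smul t (T z)" using h(2) by (simp add: tensor_apply)
      moreover from this have "h (T u) = t" using h by (simp add: dualD(3)[OF h(1)])
      ultimately show ?thesis by simp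
    qed
    show ?thesis
    proof (rule that[of "\<lambda>u. h (T u)" "T z"])
      show "(\<lambda>u. h (T u)) \<in> dual" by (rule dual_comp[OF h(1) T])
      have "T = T z \<odot> (\<lambda>u. h (T u))"
        unfolding tensor_def by (rule ext) (rule Tu)
      thus "\<theta> (x \<odot> f) = T z \<odot> (\<lambda>u. h (T u))"
        by (simp only: T_def[symmetric] R_def[symmetric])
      show "h (T (T z)) = f x" using TT h by (simp add: dualD)
    qed
  qed
qed

end

section \<open>Images of rank one idempotents\<close>

locale pair_map = standard_algebra smul \<A>
  for smul :: "complex \<Rightarrow> 'a::banach \<Rightarrow> 'a" and \<A> +
  fixes \<phi> :: "('a \<Rightarrow> 'a) \<Rightarrow> 'a \<Rightarrow> 'a" and r s n :: nat
  assumes maps: "A \<in> \<A> \<Longrightarrow> \<phi> A \<in> \<A>" and rs: "r + s = Suc n"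
begin

text \<open>\<open>jordan\<close> is asked even for the ordinary product: the arguments use
  \<open>\<theta>\<close> only through additivity and its effect on rank one operators and their
  traces.\<close>

definition product_related :: "('a \<Rightarrow> 'a) \<Rightarrow> ('a \<Rightarrow> 'a) \<Rightarrow> bool" where
  "product_related A B \<longleftrightarrow> (\<exists>\<theta>. jordan \<theta> \<and>
     \<phi> A ^^ r \<circ> \<phi> B \<circ> \<phi> A ^^ s = \<theta> (A ^^ r \<circ> B \<circ> A ^^ s))"

definition jordan_related :: "('a \<Rightarrow> 'a) \<Rightarrow> ('a \<Rightarrow> 'a) \<Rightarrow> bool" where
  "jordan_related A B \<longleftrightarrow> (\<exists>\<theta>. jordan \<theta> \<and>
     (\<lambda>u. (\<phi> A ^^ r \<circ> \<phi> B \<circ> \<phi> A ^^ s) u + (\<phi> A ^^ s \<circ> \<phi> B \<circ> \<phi> A ^^ r) u) =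
     \<theta> (\<lambda>u. (A ^^ r \<circ> B \<circ> A ^^ s) u + (A ^^ s \<circ> B \<circ> A ^^ r) u))"

text \<open>Both halves of a Jordan product have the same trace, so in that case the comparison
  reads 2 t' = 2 t. Both relations therefore lead to the same trace identity.\<close>

lemma related_trace:
  assumes rel: "product_related A B \<or> jordan_related A B" and AB: "A \<in> \<A>" "B \<in> \<A>"
    and d: "d1 \<in> dual" "d2 \<in> dual" "d3 \<in> dual" "d4 \<in> dual"
    and A: "A ^^ r \<circ> B \<circ> A ^^ s = c1 \<odot> d1" "A ^^ s \<circ> B \<circ> A ^^ r = c2 \<odot> d2"
    and \<phi>A: "\<phi> A ^^ r \<circ> \<phi> B \<circ> \<phi> A ^^ s = c3 \<odot> d3" "\<phi> A ^^ s \<circ> \<phi> B \<circ> \<phi> A ^^ r = c4 \<odot> d4"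
    and t: "d1 c1 = t" "d2 c2 = t" "d3 c3 = t'" "d4 c4 = t'"
  shows "t' = t"
  using rel
proof
  assume "product_related A B"
  then obtain \<theta> where \<theta>: "jordan \<theta>" "c3 \<odot> d3 = \<theta> (c1 \<odot> d1)"
    unfolding product_related_def A \<phi>A by blast
  obtain a b where b: "b \<in> dual" "\<theta> (c1 \<odot> d1) = a \<odot> b" "b a = d1 c1" by (rule jordan_tensor[OF \<theta>(1) d(1)])
  have "d3 c3 = b a" by (rule trace_unique[OF d(3) b(1)]) (simp only: \<theta>(2) b(2))
  thus ?thesis using t b by simp
next
  assume "jordan_related A B"
  then obtain \<theta> where \<theta>: "jordan \<theta>"
    "(\<lambda>u. (c3 \<odot> d3) u + (c4 \<odot> d4) u) = \<theta> (\<lambda>u. (c1 \<odot> d1) u + (c2 \<odot> d2) u)"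
    unfolding jordan_related_def A \<phi>A by blast
  obtain a b where b: "b \<in> dual" "\<theta> (c1 \<odot> d1) = a \<odot> b" "b a = d1 c1" by (rule jordan_tensor[OF \<theta>(1) d(1)])
  obtain a' b' where b': "b' \<in> dual" "\<theta> (c2 \<odot> d2) = a' \<odot> b'" "b' a' = d2 c2"
    by (rule jordan_tensor[OF \<theta>(1) d(2)])
  have "(\<lambda>u. (c3 \<odot> d3) u + (c4 \<odot> d4) u) = (\<lambda>u. (a \<odot> b) u + (a' \<odot> b') u)"
    unfolding \<theta>(2) jordanD(2)[OF \<theta>(1) A_tensor[OF d(1)] A_tensor[OF d(2)]] b b' ..
  hence "d3 c3 + d4 c4 = b a + b' a'" by (intro trace_unique2 d b(1) b'(1)) (rule fun_cong)
  thus ?thesis using t b b' by simp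
qed

end

text \<open>The second alternative carries \<open>r \<noteq> s\<close>, which the cancelling
  eigenvalue \<open>\<zeta>\<close> requires. A Jordan product with r = s is covered by the first
  alternative after halving.\<close>

locale product_preserver = pair_map +
  assumes hyp: "((\<forall>A\<in>\<A>. \<forall>B\<in>\<A>. rank_one A \<or> rank_one B \<longrightarrow> product_related A B) \<and>
        (\<forall>x y. \<forall>f\<in>dual. \<forall>g\<in>dual. (\<lambda>u. (x \<odot> f) u + (y \<odot> g) u) \<in> \<phi> ` \<A>)) \<or>
      (r \<noteq> s \<and> (\<forall>A\<in>\<A>. \<forall>B\<in>\<A>. rank_one A \<or> rank_one B \<longrightarrow> jordan_related A B) \<and>
        (\<forall>x y z. \<forall>f\<in>dual. \<forall>g\<in>dual. \<forall>h\<in>dual. (\<lambda>u. (x \<odot> f) u + (y \<odot> g) u + (z \<odot> h) u) \<in> \<phi> ` \<A>))"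
begin

lemma related: "A \<in> \<A> \<Longrightarrow> B \<in> \<A> \<Longrightarrow> rank_one A \<or> rank_one B \<Longrightarrow> product_related A B \<or> jordan_related A B"
  using hyp by (elim disjE conjE) simp_all

lemma tensor_in_range:
  assumes g: "g \<in> dual" obtains C where "C \<in> \<A>" "\<phi> C = y \<odot> g"
proof -
  have z: "(0 \<odot> g) u = 0" for u by (simp add: tensor_apply)
  have "(\<lambda>u. (y \<odot> g) u + (0 \<odot> g) u) \<in> \<phi> ` \<A> \<or> (\<lambda>u. (y \<odot> g) u + (0 \<odot> g) u + (0 \<odot> g) u) \<in> \<phi> ` \<A>"
    using hyp g by (elim disjE conjE) simp_all
  hence "y \<odot> g \<in> \<phi> ` \<A>" unfolding z by simp
  thus ?thesis using that by (metis imageE)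
qed

text \<open>The source of linearity: C depends on y and g only, and the right side is linear in x
  and in f. The condition \<open>g y = 1\<close> absorbs the factor \<open>g y ^ n\<close>.\<close>

lemma image_trace:
  assumes C: "C \<in> \<A>" "\<phi> C = y \<odot> g" and g: "g \<in> dual" "g y = 1" and f: "f \<in> dual"
  shows "g (\<phi> (x \<odot> f) y) = f ((C ^^ Suc n) x)"
proof -
  have Z: "bop (\<phi> (x \<odot> f))" using A_bop maps A_tensor[OF f] by blast
  have sr: "s + r = Suc n" using rs by simp
  obtain c1 d1 where 1: "d1 \<in> dual" "C ^^ r \<circ> (x \<odot> f) \<circ> C ^^ s = c1 \<odot> d1" "d1 c1 = f ((C ^^ (r + s)) x)"
    by (rule sandwiched_tensor[OF f A_bop[OF C(1)]])
  obtain c2 d2 where 2: "d2 \<in> dual" "C ^^ s \<circ> (x \<odot> f) \<circ> C ^^ r = c2 \<odot> d2" "d2 c2 = f ((C ^^ (s + r)) x)"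
    by (rule sandwiched_tensor[OF f A_bop[OF C(1)]])
  obtain c3 d3 where 3: "d3 \<in> dual" "\<phi> C ^^ r \<circ> \<phi> (x \<odot> f) \<circ> \<phi> C ^^ s = c3 \<odot> d3"
      "d3 c3 = g y ^ n * g (\<phi> (x \<odot> f) y)"
    unfolding C(2) by (rule tensor_sandwich[OF g(1) Z rs])
  obtain c4 d4 where 4: "d4 \<in> dual" "\<phi> C ^^ s \<circ> \<phi> (x \<odot> f) \<circ> \<phi> C ^^ r = c4 \<odot> d4"
      "d4 c4 = g y ^ n * g (\<phi> (x \<odot> f) y)"
    unfolding C(2) by (rule tensor_sandwich[OF g(1) Z sr])
  show ?thesis
    by (rule related_trace[OF related[OF C(1) A_tensor[OF f]] C(1) A_tensor[OF f] 1(1) 2(1) 3(1) 4(1) 1(2) 2(2) 3(2) 4(2)])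
      (use 1 2 3 4 g rs sr rank_one_tensor[OF f] in simp_all)
qed

text \<open>Here the rank one operator fills the repeated variable and B is arbitrary; this is how
  the values of \<open>\<phi>\<close> on the whole algebra are tied to those on rank one
  operators.\<close>

lemma tensor_trace:
  assumes f: "f \<in> dual" and b: "b \<in> dual" and eq: "\<phi> (x \<odot> f) = a \<odot> b" and B: "B \<in> \<A>"
  shows "b a ^ n * b (\<phi> B a) = f x ^ n * f (B x)"
proof -
  let ?A = "x \<odot> f"
  have Z: "bop (\<phi> B)" "bop B" using A_bop maps B by blast+
  have A: "?A \<in> \<A>" by (rule A_tensor[OF f])
  have sr: "s + r = Suc n" using rs by simp
  obtain c1 d1 where 1: "d1 \<in> dual" "?A ^^ r \<circ> B \<circ> ?A ^^ s = c1 \<odot> d1" "d1 c1 = f x ^ n * f (B x)"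
    by (rule tensor_sandwich[OF f Z(2) rs])
  obtain c2 d2 where 2: "d2 \<in> dual" "?A ^^ s \<circ> B \<circ> ?A ^^ r = c2 \<odot> d2" "d2 c2 = f x ^ n * f (B x)"
    by (rule tensor_sandwich[OF f Z(2) sr])
  obtain c3 d3 where 3: "d3 \<in> dual" "\<phi> ?A ^^ r \<circ> \<phi> B \<circ> \<phi> ?A ^^ s = c3 \<odot> d3" "d3 c3 = b a ^ n * b (\<phi> B a)"
    unfolding eq by (rule tensor_sandwich[OF b Z(1) rs])
  obtain c4 d4 where 4: "d4 \<in> dual" "\<phi> ?A ^^ s \<circ> \<phi> B \<circ> \<phi> ?A ^^ r = c4 \<odot> d4" "d4 c4 = b a ^ n * b (\<phi> B a)"
    unfolding eq by (rule tensor_sandwich[OF b Z(1) sr])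
  show ?thesis
    by (rule related_trace[OF related[OF A B] A B 1(1) 2(1) 3(1) 4(1) 1(2) 2(2) 3(2) 4(2) 1(3) 2(3) 3(3) 4(3)])
      (simp add: rank_one_tensor[OF f])
qed

text \<open>Setting A = B = P turns the product into the power of exponent r + s + 1 = n + 2, and P
  equals its own powers; the Jordan product is twice this.\<close>

lemma idempotent_image_power:
  assumes f: "f \<in> dual" and fx: "f x = 1"
  obtains a b where "b \<in> dual" "b a = 1" "\<phi> (x \<odot> f) ^^ Suc (Suc n) = a \<odot> b"
proof -
  let ?P = "x \<odot> f"
  have P: "?P \<in> \<A>" by (rule A_tensor[OF f])
  have pow: "T ^^ i \<circ> T \<circ> T ^^ j = T ^^ Suc (i + j)" for T :: "'a \<Rightarrow> 'a" and i j
    by (simp add: funpow_add fun_eq_iff funpow_swap1)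
  have sr: "s + r = Suc n" using rs by simp
  have PP: "?P ^^ Suc j = ?P" for j
    by (rule ext) (simp add: tensor_power[OF f] tensor_apply fx del: funpow.simps)
  have "\<exists>\<theta>. jordan \<theta> \<and> \<phi> ?P ^^ Suc (Suc n) = \<theta> ?P"
    using related[OF P P disjI1[OF rank_one_tensor[OF f]]]
  proof
    assume "product_related ?P ?P"
    thus ?thesis unfolding product_related_def pow PP rs .
  next
    assume "jordan_related ?P ?P"
    then obtain \<theta> where \<theta>: "jordan \<theta>"
      "(\<lambda>u. (\<phi> ?P ^^ Suc (Suc n)) u + (\<phi> ?P ^^ Suc (Suc n)) u) = \<theta> (\<lambda>u. ?P u + ?P u)"
      unfolding jordan_related_def pow PP rs sr by blast
    have "(\<phi> ?P ^^ Suc (Suc n)) u = \<theta> ?P u" for u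
      using fun_cong[OF \<theta>(2)[unfolded jordanD(2)[OF \<theta>(1) P P]], of u] by (rule double_cancel)
    thus ?thesis using \<theta>(1) by blast
  qed
  then obtain \<theta> where \<theta>: "jordan \<theta>" "\<phi> ?P ^^ Suc (Suc n) = \<theta> ?P" by blast
  obtain a b where "b \<in> dual" "\<theta> ?P = a \<odot> b" "b a = f x" by (rule jordan_tensor[OF \<theta>(1) f])
  thus ?thesis using that \<theta>(2) fx by simp
qed

text \<open>U is diagonal in the basis x, y + z (respectively x, z, y + z). In the Jordan case
  \<open>\<zeta>\<^sup>r + \<zeta>\<^sup>s = 0\<close> cancels the off-diagonal entries of \<open>U\<^sup>r T U\<^sup>s + U\<^sup>s T U\<^sup>r\<close>,
  which is thus of rank three, while the operator it should be conjugate to has rank at most two.\<close>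

lemma no_jordan_block:
  assumes P: "P \<in> \<A>" "rank_one P" and T: "\<phi> P = T" "bop T" and f: "f \<in> dual" "f x = 1"
    and \<xi>: "\<xi> \<noteq> 0" "T x = smul \<xi> x" and yz: "T z = y" "T y = 0" "f y = 0" "f z = 0"
    and h: "h \<in> dual" "h x = 0" "h y = 1" "h z = 0" and g: "g \<in> dual" "g x = 0" "g y = 0" "g z = 1"
  shows False
proof -
  obtain p v where pv: "v \<in> dual" "P = p \<odot> v" using P(2) by (auto simp: rank_one_def)
  have Te: "T (y + z) = y" using T yz by (simp add: bopD)
  from hyp show ?thesis
  proof (elim disjE conjE)
    assume rel: "\<forall>A\<in>\<A>. \<forall>B\<in>\<A>. rank_one A \<or> rank_one B \<longrightarrow> product_related A B"
      and range: "\<forall>x y. \<forall>f\<in>dual. \<forall>g\<in>dual. (\<lambda>u. (x \<odot> f) u + (y \<odot> g) u) \<in> \<phi> ` \<A>"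
    define U where "U = (\<lambda>u. (x \<odot> f) u + ((y + z) \<odot> h) u)"
    have "U \<in> \<phi> ` \<A>" unfolding U_def using range f(1) h(1) by blast
    then obtain C where C: "C \<in> \<A>" "\<phi> C = U" by (metis imageE)
    have "product_related C P" using rel C(1) P by blast
    then obtain \<theta> where \<theta>: "jordan \<theta>" "U ^^ r \<circ> T \<circ> U ^^ s = \<theta> (C ^^ r \<circ> P \<circ> C ^^ s)"
      unfolding product_related_def C T by blast
    obtain c d where cd: "d \<in> dual" "C ^^ r \<circ> P \<circ> C ^^ s = c \<odot> d"
      unfolding pv(2) by (rule sandwiched_tensor[OF pv(1) A_bop[OF C(1)]])
    obtain a b where ab: "b \<in> dual" "\<theta> (c \<odot> d) = a \<odot> b" by (rule jordan_tensor[OF \<theta>(1) cd(1)])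
    have W: "(U ^^ r) (T ((U ^^ s) u)) = smul (b u) a" for u
      using fun_cong[OF \<theta>(2), of u] unfolding cd ab by (simp add: tensor_apply)
    have Uf: "f ((U ^^ j) u) = f u" and Uh: "h ((U ^^ j) u) = h u" for j u
      by (induction j) (use f h yz in \<open>auto simp: U_def tensor_apply dualD\<close>)
    have Ux: "(U ^^ j) x = x" and Ue: "(U ^^ j) (y + z) = y + z" for j
      by (induction j) (use f h yz in \<open>auto simp: U_def tensor_apply dualD\<close>)
    \<comment> \<open>In the coordinates f, h and on the vectors x, y + z the sandwiched operator is
      diagonal with entries \<open>\<xi>\<close> and 1, which an operator \<open>a \<odot> b\<close>
      cannot be: the first column forces h a = 0, the second h a nonzero.\<close>
    have "f (smul (b x) a) = \<xi>" "h (smul (b x) a) = 0"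
      unfolding W[of x, symmetric] Ux \<xi>(2) Uf Uh using f h by (simp_all add: dualD)
    moreover have "h (smul (b (y + z)) a) = 1"
      unfolding W[symmetric] Ue Te Uh by (rule h)
    ultimately show False using f h \<xi>(1) by (auto simp: dualD)
  next
    assume ne: "r \<noteq> s" and rel: "\<forall>A\<in>\<A>. \<forall>B\<in>\<A>. rank_one A \<or> rank_one B \<longrightarrow> jordan_related A B"
      and range: "\<forall>x y z. \<forall>f\<in>dual. \<forall>g\<in>dual. \<forall>h\<in>dual. (\<lambda>u. (x \<odot> f) u + (y \<odot> g) u + (z \<odot> h) u) \<in> \<phi> ` \<A>"
    obtain \<zeta> :: complex where \<zeta>: "\<zeta> \<noteq> 0" "\<zeta> ^ r + \<zeta> ^ s = 0" by (rule exists_opposite_powers[OF ne])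
    \<comment> \<open>f, k, h are the coordinates dual to x, z, y + z; in particular k vanishes at y
      + z.\<close>
    define k where "k = (\<lambda>u. g u - h u)"
    have k: "k \<in> dual" "k x = 0" "k y = -1" "k z = 1"
      unfolding k_def using g h by (auto intro!: dual_diff)
    define U where "U = (\<lambda>u. (x \<odot> f) u + (z \<odot> k) u + (smul \<zeta> (y + z) \<odot> h) u)"
    have U: "bop U" unfolding U_def using f h k by (intro bop_add bop_tensor)
    have "U \<in> \<phi> ` \<A>" unfolding U_def using range f(1) h(1) k(1) by blast
    then obtain C where C: "C \<in> \<A>" "\<phi> C = U" by (metis imageE)
    have "jordan_related C P" using rel C(1) P by blast
    then obtain \<theta> where \<theta>: "jordan \<theta>"
      "(\<lambda>u. (U ^^ r \<circ> T \<circ> U ^^ s) u + (U ^^ s \<circ> T \<circ> U ^^ r) u) =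
         \<theta> (\<lambda>u. (C ^^ r \<circ> P \<circ> C ^^ s) u + (C ^^ s \<circ> P \<circ> C ^^ r) u)"
      unfolding jordan_related_def C T by blast
    obtain c d where cd: "d \<in> dual" "C ^^ r \<circ> P \<circ> C ^^ s = c \<odot> d"
      unfolding pv(2) by (rule sandwiched_tensor[OF pv(1) A_bop[OF C(1)]])
    obtain c' d' where cd': "d' \<in> dual" "C ^^ s \<circ> P \<circ> C ^^ r = c' \<odot> d'"
      unfolding pv(2) by (rule sandwiched_tensor[OF pv(1) A_bop[OF C(1)]])
    obtain a b where ab: "b \<in> dual" "\<theta> (c \<odot> d) = a \<odot> b" by (rule jordan_tensor[OF \<theta>(1) cd(1)])
    obtain a' b' where ab': "b' \<in> dual" "\<theta> (c' \<odot> d') = a' \<odot> b'" by (rule jordan_tensor[OF \<theta>(1) cd'(1)])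
    have W: "(U ^^ r) (T ((U ^^ s) u)) + (U ^^ s) (T ((U ^^ r) u)) = smul (b u) a + smul (b' u) a'" for u
      using fun_cong[OF \<theta>(2), of u]
      unfolding cd cd' jordanD(2)[OF \<theta>(1) A_tensor[OF cd(1)] A_tensor[OF cd'(1)]] ab ab'
      by (simp add: tensor_apply)
    have Uf: "f ((U ^^ j) u) = f u" and Uk: "k ((U ^^ j) u) = k u" and Uh: "h ((U ^^ j) u) = \<zeta> ^ j * h u" for j u
      by (induction j) (use f h k yz in \<open>auto simp: U_def tensor_apply dualD\<close>)
    have Ux: "(U ^^ j) x = x" and Uz: "(U ^^ j) z = z" for j
      by (induction j) (use f h k yz in \<open>auto simp: U_def tensor_apply dualD\<close>)
    have "U (y + z) = smul \<zeta> (y + z)" using f h k yz by (auto simp: U_def tensor_apply dualD)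
    hence Ue: "(U ^^ j) (y + z) = smul (\<zeta> ^ j) (y + z)" for j by (rule funpow_eigenvector[OF U])
    have TU: "T ((U ^^ j) x) = smul \<xi> x" "T ((U ^^ j) z) = y" "T ((U ^^ j) (y + z)) = smul (\<zeta> ^ j) y" for j
      using Te T(2) by (simp_all only: Ux Uz Ue \<xi>(2) yz(1) bopD(3))
    have val: "w a * b u + w a' * b' u = w ((U ^^ r) (T ((U ^^ s) u))) + w ((U ^^ s) (T ((U ^^ r) u)))"
      if "w \<in> dual" for w u
    proof -
      have "w ((U ^^ r) (T ((U ^^ s) u)) + (U ^^ s) (T ((U ^^ r) u))) = w (smul (b u) a + smul (b' u) a')"
        by (simp only: W)
      thus ?thesis using that by (simp add: dualD mult.commute)
    qed
    have z': "\<zeta> ^ s + \<zeta> ^ r = 0" using \<zeta> by (simp add: add.commute)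
    \<comment> \<open>In this basis T z and T (y + z) both equal y = (y + z) - z. Hence the diagonal
      entries of the symmetrized product are \<open>2 \<xi>\<close>, -2 and
      \<open>2 \<zeta>^(r+s)\<close>, and the two mixed entries of z and y + z are
      \<open>\<zeta>^r + \<zeta>^s\<close> up to sign.\<close>
    have "(2 * \<xi>) * (- 2) * (2 * \<zeta> ^ (r + s)) = 0"
    proof (rule det3_rank_two)
      note s = val TU Uf Uk Uh dualD
      show "f a * b x + f a' * b' x = 2 * \<xi>" using f h k yz by (simp add: s)
      show "f a * b z + f a' * b' z = 0" using f h k yz by (simp add: s)
      show "f a * b (y + z) + f a' * b' (y + z) = 0" using f h k yz by (simp only: val TU Uf) (simp add: dualD)
      show "k a * b x + k a' * b' x = 0" using f h k yz by (simp add: s)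
      show "k a * b z + k a' * b' z = - 2" using f h k yz by (simp add: s)
      show "k a * b (y + z) + k a' * b' (y + z) = 0" using f h k yz z' by (simp only: val TU Uk) (simp add: dualD neg_eq_iff_add_eq_0 add_eq_0_iff2)
      show "h a * b x + h a' * b' x = 0" using f h k yz by (simp add: s)
      show "h a * b z + h a' * b' z = 0" using f h k yz \<zeta> by (simp add: s)
      show "h a * b (y + z) + h a' * b' (y + z) = 2 * \<zeta> ^ (r + s)"
        using f h k yz by (simp only: val TU Uh) (simp add: dualD power_add mult.commute)
    qed
    thus False using \<xi>(1) \<zeta>(1) by simp
  qed
qed

lemma idempotent_image_rank_one:
  assumes f: "f \<in> dual" and fx: "f x = 1"
  obtains a b where "b \<in> dual" "\<phi> (x \<odot> f) = a \<odot> b"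
proof -
  have P: "x \<odot> f \<in> \<A>" by (rule A_tensor[OF f])
  have T: "bop (\<phi> (x \<odot> f))" using A_bop maps P by blast
  obtain a b where ab: "b \<in> dual" "b a = 1" "\<phi> (x \<odot> f) ^^ Suc (Suc n) = a \<odot> b"
    by (rule idempotent_image_power[OF f fx])
  show ?thesis
  proof (rule root_of_rank_one_idempotent[OF T ab])
    fix \<xi> assume "\<phi> (x \<odot> f) = smul \<xi> a \<odot> b"
    thus ?thesis using that ab(1) by blast
  next
    fix \<xi> y z g h
    assume "\<xi> \<noteq> 0" "\<phi> (x \<odot> f) a = smul \<xi> a" "\<phi> (x \<odot> f) z = y" "\<phi> (x \<odot> f) y = 0" "b y = 0" "b z = 0"
      "h \<in> dual" "h a = 0" "h y = 1" "h z = 0" "g \<in> dual" "g a = 0" "g y = 0" "g z = 1"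
    from no_jordan_block[OF P rank_one_tensor[OF f] refl T ab(1,2) this] show ?thesis ..
  qed
qed

end

section \<open>Bilinear maps into rank one operators\<close>

context complex_banach
begin

text \<open>Stated for abstract index sets X and Y with a pairing, so that it applies both to
  \<open>(x, f) \<mapsto> \<beta> x f\<close> and to the same map with its arguments swapped.\<close>

lemma rank_one_bilinear_structure:
  fixes X :: "'x set" and Y :: "'y set" and pair :: "'x \<Rightarrow> 'y \<Rightarrow> complex"
    and \<beta> :: "'x \<Rightarrow> 'y \<Rightarrow> 'a \<Rightarrow> 'a" and px :: "'x \<Rightarrow> 'x" and py :: "'y \<Rightarrow> 'y"
  assumes x0: "x0 \<in> X" and f0: "f0 \<in> Y"
    and px: "\<And>x. x \<in> X \<Longrightarrow> px x \<in> X" and py: "\<And>f. f \<in> Y \<Longrightarrow> py f \<in> Y"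
    and pair_px: "\<And>x f. x \<in> X \<Longrightarrow> f \<in> Y \<Longrightarrow> pair (px x) f = pair x0 f + pair x f"
    and pair_py: "\<And>x f. x \<in> X \<Longrightarrow> f \<in> Y \<Longrightarrow> pair x (py f) = pair x f0 + pair x f"
    and \<beta>_px: "\<And>x f v. x \<in> X \<Longrightarrow> f \<in> Y \<Longrightarrow> \<beta> (px x) f v = \<beta> x0 f v + \<beta> x f v"
    and \<beta>_py: "\<And>x f v. x \<in> X \<Longrightarrow> f \<in> Y \<Longrightarrow> \<beta> x (py f) v = \<beta> x f0 v + \<beta> x f v"
    and rank: "\<And>x f. x \<in> X \<Longrightarrow> f \<in> Y \<Longrightarrow> \<exists>a b. b \<in> dual \<and> \<beta> x f = a \<odot> b"
    and form: "\<And>x f u g a b c d. x \<in> X \<Longrightarrow> f \<in> Y \<Longrightarrow> u \<in> X \<Longrightarrow> g \<in> Y \<Longrightarrow> b \<in> dual \<Longrightarrow> d \<in> dual \<Longrightarrow>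
        \<beta> x f = a \<odot> b \<Longrightarrow> \<beta> u g = c \<odot> d \<Longrightarrow> b c * d a = pair u f * pair x g"
    and trace: "\<And>x f a b. x \<in> X \<Longrightarrow> f \<in> Y \<Longrightarrow> b \<in> dual \<Longrightarrow> \<beta> x f = a \<odot> b \<Longrightarrow> b a = pair x f"
    and homX: "\<And>x f t. x \<in> X \<Longrightarrow> f \<in> Y \<Longrightarrow> (\<And>g. g \<in> Y \<Longrightarrow> pair x g = t * pair x0 g) \<Longrightarrow>
        \<beta> x f = (\<lambda>v. smul t (\<beta> x0 f v))"
    and homY: "\<And>x f t. x \<in> X \<Longrightarrow> f \<in> Y \<Longrightarrow> (\<And>u. u \<in> X \<Longrightarrow> pair u f = t * pair u f0) \<Longrightarrow>
        \<beta> x f = (\<lambda>v. smul t (\<beta> x f0 v))"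
    and g0: "g0 \<in> dual" "g0 y0 = 1" and base: "\<beta> x0 f0 = y0 \<odot> g0"
    and row: "\<And>x. x \<in> X \<Longrightarrow> \<exists>p. \<beta> x f0 = p \<odot> g0"
    and x: "x \<in> X" and f: "f \<in> Y"
  shows "\<beta> x f = (\<beta> x f0 y0) \<odot> (\<lambda>v. g0 (\<beta> x0 f v))"
proof -
  define S where "S x = \<beta> x f0 y0" for x
  define C where "C f = (\<lambda>v. g0 (\<beta> x0 f v))" for f
  have y0: "y0 \<noteq> 0" using g0 dualD(4)[OF g0(1)] by auto
  have pair00: "pair x0 f0 = 1" using trace[OF x0 f0 g0(1) base] g0 by simp
  have S: "\<beta> x f0 = S x \<odot> g0" if x: "x \<in> X" for x
  proof -
    obtain p where "\<beta> x f0 = p \<odot> g0" using row[OF x] by blast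
    thus ?thesis using g0 by (simp add: S_def tensor_apply)
  qed
  have g0S: "g0 (S x) = pair x f0" if "x \<in> X" for x using trace[OF that f0 g0(1) S[OF that]] .
  have S0: "S x0 = y0" using g0 by (simp add: S_def base tensor_apply)
  have C: "\<beta> x0 f = y0 \<odot> C f" and C_dual: "C f \<in> dual" if f: "f \<in> Y" for f
  proof -
    obtain p q where pq: "q \<in> dual" "\<beta> x0 f = p \<odot> q" using rank[OF x0 f] by blast
    obtain e h where eh: "h \<in> dual" "\<beta> x0 (py f) = e \<odot> h" using rank[OF x0 py[OF f]] by blast
    have "(y0 \<odot> g0) v + (p \<odot> q) v = (e \<odot> h) v" for v
      using \<beta>_py[OF x0 f, of v] unfolding base pq(2) eh(2) by simp
    moreover have "g0 y0 \<noteq> 0" using g0 by simp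
    ultimately have "(\<exists>t. p = smul t y0) \<or> (\<exists>t. q = (\<lambda>u. t * g0 u))"
      by (intro tensor_add_dichotomy[OF g0(1) pq(1) eh(1) _ y0])
    thus "\<beta> x0 f = y0 \<odot> C f"
    proof (elim disjE exE)
      fix t assume "p = smul t y0"
      thus ?thesis using g0 by (simp add: pq(2) C_def tensor_def dualD)
    next
      \<comment> \<open>In this alternative \<open>form\<close> and \<open>row\<close> show that f
        pairs like a multiple of f0, and \<open>homY\<close> then makes \<open>\<beta> x0 f\<close>
        a multiple of \<open>y0 \<odot> g0\<close>.\<close>
      fix t assume t: "q = (\<lambda>u. t * g0 u)"
      have "pair u f = (g0 p * t) * pair u f0" if "u \<in> X" for u
        using form[OF that f0 x0 f g0(1) pq(1) S[OF that] pq(2)] g0S[OF that] pair00 t by (simp add: mult.assoc)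
      hence "\<beta> x0 f = (\<lambda>v. smul (g0 p * t) (\<beta> x0 f0 v))" by (rule homY[OF x0 f])
      thus ?thesis using g0 by (simp add: base C_def tensor_def dualD)
    qed
    show "C f \<in> dual" unfolding C_def pq(2) by (rule dual_comp[OF g0(1) bop_tensor[OF pq(1)]])
  qed
  have C0: "C f0 = g0" using g0 by (simp add: C_def base tensor_def dualD)
  have Cy0: "C f y0 = pair x0 f" if "f \<in> Y" for f
    using form[OF x0 f0 x0 that g0(1) C_dual[OF that] base C[OF that]] g0 pair00 by simp
  \<comment> \<open>The conditions \<open>nz\<close> make S x and C f nonzero, as the dichotomy
    requires: their values under g0 and at y0 are \<open>pair x f0\<close> and
    \<open>pair x0 f\<close>. Comparison with \<open>\<beta> x f0\<close> fixes the vector,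
    comparison with \<open>\<beta> x0 f\<close> the functional, and \<open>form\<close> fixes the
    scalar.\<close>
  have generic: "\<beta> x f = S x \<odot> C f" if x: "x \<in> X" and f: "f \<in> Y" and nz: "pair x f0 \<noteq> 0" "pair x0 f \<noteq> 0" for x f
  proof -
    have Sx: "S x \<noteq> 0" using g0S[OF x] nz(1) dualD(4)[OF g0(1)] by auto
    obtain p q where pq: "q \<in> dual" "\<beta> x f = p \<odot> q" using rank[OF x f] by blast
    obtain e h where eh: "h \<in> dual" "\<beta> x (py f) = e \<odot> h" using rank[OF x py[OF f]] by blast
    have "(S x \<odot> g0) v + (p \<odot> q) v = (e \<odot> h) v" for v
      using \<beta>_py[OF x f, of v] unfolding S[OF x] pq(2) eh(2) by simp
    moreover have "g0 y0 \<noteq> 0" using g0 by simp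
    ultimately have "(\<exists>t. p = smul t (S x)) \<or> (\<exists>t. q = (\<lambda>u. t * g0 u))"
      by (intro tensor_add_dichotomy[OF g0(1) pq(1) eh(1) _ Sx])
    hence "\<exists>q'. q' \<in> dual \<and> \<beta> x f = S x \<odot> q'"
    proof (elim disjE exE)
      fix t assume "p = smul t (S x)"
      hence "\<beta> x f = S x \<odot> (\<lambda>u. t * q u)" by (simp add: pq(2) tensor_def mult.commute)
      thus ?thesis using dual_scale[OF pq(1)] by blast
    next
      fix t assume t: "q = (\<lambda>u. t * g0 u)"
      have "pair u f = (g0 p * t / pair x f0) * pair u f0" if "u \<in> X" for u
        using form[OF that f0 x f g0(1) pq(1) S[OF that] pq(2)] g0S[OF that] nz t
        by (simp add: field_simps)
      hence "\<beta> x f = (\<lambda>v. smul (g0 p * t / pair x f0) (\<beta> x f0 v))" by (rule homY[OF x f])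
      hence "\<beta> x f = S x \<odot> (\<lambda>u. (g0 p * t / pair x f0) * g0 u)" by (simp add: S[OF x] tensor_def)
      thus ?thesis using dual_scale[OF g0(1)] by blast
    qed
    then obtain q' where q': "q' \<in> dual" "\<beta> x f = S x \<odot> q'" by blast
    obtain e' h' where eh': "h' \<in> dual" "\<beta> (px x) f = e' \<odot> h'" using rank[OF px[OF x] f] by blast
    have "(y0 \<odot> C f) v + (S x \<odot> q') v = (e' \<odot> h') v" for v
      using \<beta>_px[OF x f, of v] unfolding C[OF f] q'(2) eh'(2) by simp
    moreover have "C f y0 \<noteq> 0" using Cy0[OF f] nz by simp
    ultimately have "(\<exists>t. S x = smul t y0) \<or> (\<exists>t. q' = (\<lambda>u. t * C f u))"
      by (intro tensor_add_dichotomy[OF C_dual[OF f] q'(1) eh'(1) _ y0])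
    thus ?thesis
    proof (elim disjE exE)
      fix t assume t: "S x = smul t y0"
      have "pair x g = t * pair x0 g" if g: "g \<in> Y" for g
        using form[OF x f0 x0 g g0(1) C_dual[OF g] S[OF x] C[OF g]] Cy0[OF g] t g0 pair00 C_dual[OF g]
        by (simp add: dualD)
      hence "\<beta> x f = (\<lambda>v. smul t (\<beta> x0 f v))" by (rule homX[OF x f])
      thus ?thesis by (simp add: C[OF f] t tensor_def mult.commute)
    next
      fix t assume t: "q' = (\<lambda>u. t * C f u)"
      have "g0 (S x) * q' y0 = pair x f0 * pair x0 f"
        by (rule form[OF x0 f0 x f g0(1) q'(1) base q'(2)])
      hence "t = 1" using nz g0S[OF x] Cy0[OF f] t by simp
      thus ?thesis using q'(2) t by simp
    qed
  qed
  have step: "\<beta> x f = S x \<odot> C f" if x: "x \<in> X" and f: "f \<in> Y" and nz: "pair x0 f \<noteq> 0" for x f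
  proof (cases "pair x f0 = 0")
    case False
    thus ?thesis using generic x f nz by blast
  next
    case True
    \<comment> \<open>Adding the base point x0 restores the nonvanishing condition; additivity then
      removes it again. The same is done below for f.\<close>
    hence "pair (px x) f0 \<noteq> 0" using pair_px[OF x f0] pair00 by simp
    hence eq: "\<beta> (px x) f = S (px x) \<odot> C f" using generic px[OF x] f nz by blast
    have "S (px x) = y0 + S x" using \<beta>_px[OF x f0, of y0] S0 by (simp add: S_def)
    hence "\<beta> x0 f v + \<beta> x f v = (y0 \<odot> C f) v + (S x \<odot> C f) v" for v
      using fun_cong[OF eq, of v] \<beta>_px[OF x f, of v] by (simp add: tensor_add_left)
    thus ?thesis unfolding C[OF f] by (intro ext) simp
  qed
  have "\<beta> x f = S x \<odot> C f"
  proof (cases "pair x0 f = 0")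
    case False
    thus ?thesis using step x f by blast
  next
    case True
    hence "pair x0 (py f) \<noteq> 0" using pair_py[OF x0 f] pair00 by simp
    hence eq: "\<beta> x (py f) = S x \<odot> C (py f)" using step py[OF f] x by blast
    have "C (py f) = (\<lambda>v. g0 v + C f v)"
      using g0 C0 \<beta>_py[OF x0 f] by (auto simp: C_def dualD fun_eq_iff)
    hence "\<beta> x f0 v + \<beta> x f v = (S x \<odot> g0) v + (S x \<odot> C f) v" for v
      using fun_cong[OF eq, of v] \<beta>_py[OF x f, of v] by (simp add: tensor_add_right)
    thus ?thesis unfolding S[OF x] by (intro ext) simp
  qed
  thus ?thesis by (simp add: S_def C_def)
qed

end

section \<open>Linearity, rank and trace of the map on rank one operators\<close>

context product_preserver
begin

lemma \<phi>_bop: "A \<in> \<A> \<Longrightarrow> bop (\<phi> A)"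
  using A_bop maps by blast

lemma \<phi>_tensor_bop: "f \<in> dual \<Longrightarrow> bop (\<phi> (x \<odot> f))"
  by (intro \<phi>_bop A_tensor)

lemma \<phi>_eqI:
  assumes "bop Z" "bop Z'"
    and "\<And>C y g. C \<in> \<A> \<Longrightarrow> \<phi> C = y \<odot> g \<Longrightarrow> g \<in> dual \<Longrightarrow> g y = 1 \<Longrightarrow> g (Z y) = g (Z' y)"
  shows "Z = Z'"
proof (rule bop_eqI[OF assms(1,2)])
  fix y g assume g: "g \<in> dual" "g y = 1"
  obtain C where C: "C \<in> \<A>" "\<phi> C = y \<odot> g" by (rule tensor_in_range[OF g(1)])
  show "g (Z y) = g (Z' y)" by (rule assms(3)[OF C g])
qed

text \<open>One preimage C of the test idempotent serves all three terms, and
  \<open>image_trace\<close> replaces each by an expression additive in x. The other linearity rules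
  follow in the same way.\<close>

lemma \<phi>_add_left:
  assumes f: "f \<in> dual"
  shows "\<phi> ((x + y) \<odot> f) = (\<lambda>u. \<phi> (x \<odot> f) u + \<phi> (y \<odot> f) u)"
proof (rule \<phi>_eqI)
  fix C v g assume C: "C \<in> \<A>" "\<phi> C = v \<odot> g" and g: "g \<in> dual" "g v = 1"
  have "bop (C ^^ Suc n)" by (rule bop_funpow[OF A_bop[OF C(1)]])
  thus "g (\<phi> ((x + y) \<odot> f) v) = g (\<phi> (x \<odot> f) v + \<phi> (y \<odot> f) v)"
    unfolding dualD(2)[OF g(1)] image_trace[OF C g f] using f by (simp only: bopD dualD)
qed (intro bop_add \<phi>_tensor_bop f)+

lemma \<phi>_scale_left:
  assumes f: "f \<in> dual"
  shows "\<phi> (smul c x \<odot> f) = (\<lambda>u. smul c (\<phi> (x \<odot> f) u))"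
proof (rule \<phi>_eqI)
  fix C v g assume C: "C \<in> \<A>" "\<phi> C = v \<odot> g" and g: "g \<in> dual" "g v = 1"
  have "bop (C ^^ Suc n)" by (rule bop_funpow[OF A_bop[OF C(1)]])
  thus "g (\<phi> (smul c x \<odot> f) v) = g (smul c (\<phi> (x \<odot> f) v))"
    unfolding dualD(3)[OF g(1)] image_trace[OF C g f] using f by (simp only: bopD dualD)
qed (intro bop_scale \<phi>_tensor_bop f)+

lemma \<phi>_add_right:
  assumes f: "f \<in> dual" "h \<in> dual"
  shows "\<phi> (x \<odot> (\<lambda>u. f u + h u)) = (\<lambda>u. \<phi> (x \<odot> f) u + \<phi> (x \<odot> h) u)"
proof (rule \<phi>_eqI)
  fix C v g assume C: "C \<in> \<A>" "\<phi> C = v \<odot> g" and g: "g \<in> dual" "g v = 1"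
  show "g (\<phi> (x \<odot> (\<lambda>u. f u + h u)) v) = g (\<phi> (x \<odot> f) v + \<phi> (x \<odot> h) v)"
    unfolding dualD(2)[OF g(1)] image_trace[OF C g f(1)] image_trace[OF C g f(2)]
      image_trace[OF C g dual_add[OF f]] ..
qed (intro bop_add \<phi>_tensor_bop f dual_add)+

lemma \<phi>_zero: "\<phi> (\<lambda>_. 0) = (\<lambda>_. 0)"
  using \<phi>_scale_left[OF dual_zero, of 0 0] by (simp add: tensor_def)

text \<open>If \<open>f x = 0\<close>, pick u with \<open>f u \<noteq> 0\<close>: the affine line \<open>\<phi> ((u + t x) \<odot> f)\<close> consists of images of
  multiples of idempotents, and three rank one points on it force its direction to have rank at most one.\<close>

lemma image_rank_one:
  assumes f: "f \<in> dual"
  obtains a b where "b \<in> dual" "\<phi> (x \<odot> f) = a \<odot> b"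
proof -
  have nz: "\<exists>a b. b \<in> dual \<and> \<phi> (x \<odot> f) = a \<odot> b" if "f x \<noteq> 0" for x
  proof -
    have "f (smul (1 / f x) x) = 1" using that f by (simp add: dualD)
    then obtain a b where ab: "b \<in> dual" "\<phi> (smul (1 / f x) x \<odot> f) = a \<odot> b"
      by (rule idempotent_image_rank_one[OF f])
    have "\<phi> (smul (f x) (smul (1 / f x) x) \<odot> f) = smul (f x) a \<odot> b"
      unfolding \<phi>_scale_left[OF f, of "f x"] ab(2) by (rule tensor_scale_left[symmetric])
    hence "\<phi> (x \<odot> f) = smul (f x) a \<odot> b" using that by simp
    thus ?thesis using ab(1) by blast
  qed
  have "\<exists>a b. b \<in> dual \<and> \<phi> (x \<odot> f) = a \<odot> b"
  proof (cases "f x = 0")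
    case False thus ?thesis by (rule nz)
  next
    case fx: True
    show ?thesis
    proof (cases "\<exists>u. f u \<noteq> 0")
      case False
      hence "x \<odot> f = (\<lambda>_. 0)" by (simp add: tensor_def fun_eq_iff)
      hence "\<phi> (x \<odot> f) = 0 \<odot> f" using \<phi>_zero by (simp add: tensor_def)
      thus ?thesis using f by blast
    next
      case True
      then obtain u where u: "f u \<noteq> 0" by blast
      obtain a b where ab: "b \<in> dual" "\<phi> (u \<odot> f) = a \<odot> b" using nz[OF u] by blast
      have "f (u + x) \<noteq> 0" "f ((u + x) + x) \<noteq> 0" using u fx f by (simp_all add: dualD)
      then obtain c d e h where cd: "d \<in> dual" "\<phi> ((u + x) \<odot> f) = c \<odot> d"
        and eh: "h \<in> dual" "\<phi> (((u + x) + x) \<odot> f) = e \<odot> h"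
        using nz[of "u + x"] nz[of "(u + x) + x"] by blast
      have W1: "(a \<odot> b) v + \<phi> (x \<odot> f) v = (c \<odot> d) v" for v
        using fun_cong[OF \<phi>_add_left[OF f, of u x], of v] unfolding ab(2) cd(2) by simp
      have W2: "(c \<odot> d) v + \<phi> (x \<odot> f) v = (e \<odot> h) v" for v
        using fun_cong[OF \<phi>_add_left[OF f, of "u + x" x], of v] unfolding cd(2) eh(2) by simp
      have W: "\<phi> (x \<odot> f) v = smul (d v) c - smul (b v) a" for v
        using W1[of v] by (simp add: tensor_apply algebra_simps)
      \<comment> \<open>The third point of the line is twice the second minus the first, so
        \<open>2 c \<odot> d - a \<odot> b\<close> has rank one and the dichotomy applies.\<close>
      have sum: "(c \<odot> (\<lambda>v. 2 * d v)) v + ((- a) \<odot> b) v = (e \<odot> h) v" for v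
      proof -
        have "smul (2 * d v) c = smul (d v) c + smul (d v) c" by (simp add: cv.scale_left_distrib[symmetric])
        thus ?thesis using W2[of v] W[of v] by (simp add: tensor_apply add_diff_eq)
      qed
      show ?thesis
      proof (cases "c = 0 \<or> (\<forall>p. d p = 0)")
        case True
        hence "\<phi> (x \<odot> f) = (- a) \<odot> b" using W by (auto simp: tensor_def fun_eq_iff)
        thus ?thesis using ab(1) by blast
      next
        case False
        then obtain p where p: "2 * d p \<noteq> 0" "c \<noteq> 0" by auto
        have "(\<exists>t. - a = smul t c) \<or> (\<exists>t. b = (\<lambda>v. t * (2 * d v)))"
          by (rule tensor_add_dichotomy[OF dual_scale[OF cd(1)] ab(1) eh(1) p sum])
        thus ?thesis
        proof (elim disjE exE)
          fix t assume "- a = smul t c"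
          hence a: "a = - smul t c" by (metis minus_minus)
          have "\<phi> (x \<odot> f) = c \<odot> (\<lambda>v. d v + t * b v)"
            using W by (simp add: a tensor_def fun_eq_iff cv.scale_left_distrib mult.commute)
          thus ?thesis using dual_add[OF cd(1) dual_scale[OF ab(1)]] by blast
        next
          fix t assume b: "b = (\<lambda>v. t * (2 * d v))"
          have "\<phi> (x \<odot> f) = (c - smul (2 * t) a) \<odot> d"
            using W by (simp add: b tensor_def fun_eq_iff cv.scale_right_diff_distrib mult_ac)
          thus ?thesis using cd(1) by blast
        qed
      qed
    qed
  qed
  thus ?thesis using that by blast
qed

text \<open>The trace of \<open>\<phi> (x \<odot> f)\<close>; it is independent of the
  representation by \<open>trace_unique\<close>.\<close>

definition image_tr :: "'a \<Rightarrow> ('a \<Rightarrow> complex) \<Rightarrow> complex" where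
  "image_tr x f = (THE c. \<exists>a b. b \<in> dual \<and> \<phi> (x \<odot> f) = a \<odot> b \<and> c = b a)"

lemma image_tr: "b \<in> dual \<Longrightarrow> \<phi> (x \<odot> f) = a \<odot> b \<Longrightarrow> image_tr x f = b a"
  unfolding image_tr_def by (rule the_equality) (auto intro: trace_unique)

lemma image_tr_add_left:
  assumes f: "f \<in> dual" shows "image_tr (x + y) f = image_tr x f + image_tr y f"
proof -
  obtain a b where 1: "b \<in> dual" "\<phi> (x \<odot> f) = a \<odot> b" by (rule image_rank_one[OF f])
  obtain a' b' where 2: "b' \<in> dual" "\<phi> (y \<odot> f) = a' \<odot> b'" by (rule image_rank_one[OF f])
  obtain a'' b'' where 3: "b'' \<in> dual" "\<phi> ((x + y) \<odot> f) = a'' \<odot> b''" by (rule image_rank_one[OF f])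
  have "b a + b' a' = b'' a'' + 0"
    using trace_unique2[OF 1(1) 2(1) 3(1) dual_zero, of a a' a'' 0] \<phi>_add_left[OF f, of x y]
    unfolding 1(2) 2(2) 3(2) by (simp add: tensor_def fun_eq_iff)
  thus ?thesis by (simp add: image_tr[OF 1] image_tr[OF 2] image_tr[OF 3])
qed

lemma image_tr_add_right:
  assumes f: "f \<in> dual" "h \<in> dual" shows "image_tr x (\<lambda>u. f u + h u) = image_tr x f + image_tr x h"
proof -
  obtain a b where 1: "b \<in> dual" "\<phi> (x \<odot> f) = a \<odot> b" by (rule image_rank_one[OF f(1)])
  obtain a' b' where 2: "b' \<in> dual" "\<phi> (x \<odot> h) = a' \<odot> b'" by (rule image_rank_one[OF f(2)])
  obtain a'' b'' where 3: "b'' \<in> dual" "\<phi> (x \<odot> (\<lambda>u. f u + h u)) = a'' \<odot> b''"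
    by (rule image_rank_one[OF dual_add[OF f]])
  have "b a + b' a' = b'' a'' + 0"
    using trace_unique2[OF 1(1) 2(1) 3(1) dual_zero, of a a' a'' 0] \<phi>_add_right[OF f, of x]
    unfolding 1(2) 2(2) 3(2) by (simp add: tensor_def fun_eq_iff)
  thus ?thesis by (simp add: image_tr[OF 1] image_tr[OF 2] image_tr[OF 3])
qed

lemma image_tr_scale_left:
  assumes f: "f \<in> dual" shows "image_tr (smul c x) f = c * image_tr x f"
proof -
  obtain a b where 1: "b \<in> dual" "\<phi> (x \<odot> f) = a \<odot> b" by (rule image_rank_one[OF f])
  have 2: "\<phi> (smul c x \<odot> f) = smul c a \<odot> b" using \<phi>_scale_left[OF f, of c x] 1 by (simp add: tensor_scale_left)
  show ?thesis using 1(1) by (simp add: image_tr[OF 1] image_tr[OF 1(1) 2] dualD)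
qed

lemma image_tr_scale_right:
  assumes f: "f \<in> dual" shows "image_tr x (\<lambda>u. c * f u) = c * image_tr x f"
proof -
  have "smul c x \<odot> f = x \<odot> (\<lambda>u. c * f u)" by (simp add: tensor_scale_left tensor_scale_right)
  hence "image_tr x (\<lambda>u. c * f u) = image_tr (smul c x) f" by (simp add: image_tr_def)
  thus ?thesis using image_tr_scale_left[OF f] by simp
qed

lemma image_tr_power:
  assumes f: "f \<in> dual" shows "image_tr x f ^ (n + 2) = f x ^ (n + 2)"
proof -
  obtain a b where 1: "b \<in> dual" "\<phi> (x \<odot> f) = a \<odot> b" by (rule image_rank_one[OF f])
  have "b a ^ n * (b a * b a) = f x ^ n * (f x * f x)"
    using tensor_trace[OF f 1 A_tensor[OF f, of x]] f 1(1) unfolding 1(2) by (simp add: tensor_apply dualD)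
  thus ?thesis unfolding image_tr[OF 1] by (simp add: power_add power2_eq_square mult_ac)
qed

text \<open>By \<open>image_tr_power\<close> this bilinear form vanishes wherever
  \<open>f x = 0\<close>, hence is a multiple of the pairing. The constant is its value at one pair
  with \<open>f0 x0 = 1\<close>, so its m-th power is 1.\<close>

lemma image_tr_const:
  assumes "(x0::'a) \<noteq> 0"
  obtains \<xi> where "\<xi> ^ (n + 2) = 1" "\<And>x f. f \<in> dual \<Longrightarrow> image_tr x f = \<xi> * f x"
proof -
  obtain f0 where f0: "f0 \<in> dual" "f0 x0 = 1" by (rule exists_dual[OF assms])
  define \<xi> where "\<xi> = image_tr x0 f0"
  have zero: "image_tr x f = 0" if "f \<in> dual" "f x = 0" for x f
    using image_tr_power[OF that(1), of x] that(2) by auto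
  have 1: "image_tr x f0 = \<xi> * f0 x" for x
  proof -
    have "image_tr ((x + smul (- f0 x) x0) + smul (f0 x) x0) f0 = f0 x * \<xi>"
      unfolding image_tr_add_left[OF f0(1), of "x + smul (- f0 x) x0"] image_tr_scale_left[OF f0(1)] \<xi>_def
      by (subst zero) (use f0 in \<open>auto simp: dualD\<close>)
    thus ?thesis by (simp add: mult.commute)
  qed
  \<comment> \<open>f is split into a multiple of f0 and a functional vanishing at x, on which the
    form is zero. The excluded vectors are then reached by adding x0.\<close>
  have 2: "image_tr x f = \<xi> * f x" if f: "f \<in> dual" and nz: "f0 x \<noteq> 0" for x f
  proof -
    let ?c = "f x / f0 x"
    let ?g = "\<lambda>u. f u + (- ?c) * f0 u" and ?h = "\<lambda>u. ?c * f0 u"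
    have g: "?g \<in> dual" "?h \<in> dual"
      by (rule dual_add[OF f dual_scale[OF f0(1)]], rule dual_scale[OF f0(1)])
    have "image_tr x (\<lambda>u. ?g u + ?h u) = image_tr x ?g + image_tr x ?h" by (rule image_tr_add_right[OF g])
    moreover have "image_tr x ?g = 0" by (rule zero[OF g(1)]) (use nz in simp)
    moreover have "image_tr x ?h = ?c * (\<xi> * f0 x)" by (simp only: image_tr_scale_right[OF f0(1)] 1)
    moreover have "(\<lambda>u. ?g u + ?h u) = f" by auto
    ultimately show ?thesis using nz by simp
  qed
  have "image_tr x f = \<xi> * f x" if f: "f \<in> dual" for x f
  proof (cases "f0 x = 0")
    case False thus ?thesis by (rule 2[OF f])
  next
    case True
    hence "image_tr (x + x0) f = \<xi> * f (x + x0)" using f0 by (intro 2[OF f]) (simp add: dualD)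
    moreover have "image_tr x0 f = \<xi> * f x0" using f0 by (intro 2[OF f]) simp
    ultimately show ?thesis using image_tr_add_left[OF f, of x x0] f by (simp add: dualD algebra_simps)
  qed
  moreover have "\<xi> ^ (n + 2) = 1" using image_tr_power[OF f0(1), of x0] f0(2) by (simp add: \<xi>_def)
  ultimately show ?thesis using that by blast
qed

end

section \<open>Spatial form\<close>

text \<open>The properties of \<open>\<phi>\<close> divided by the root of unity.
  \<open>form\<close> says that the trace of \<open>\<psi> R\<close> times \<open>\<psi> B\<close>
  equals that of R times B for R of rank one.\<close>

locale trace_form_preserver = standard_algebra smul \<A>
  for smul :: "complex \<Rightarrow> 'a::banach \<Rightarrow> 'a" and \<A> +
  fixes \<psi> :: "('a \<Rightarrow> 'a) \<Rightarrow> 'a \<Rightarrow> 'a"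
  assumes maps: "A \<in> \<A> \<Longrightarrow> \<psi> A \<in> \<A>"
    and range: "g \<in> dual \<Longrightarrow> \<exists>C\<in>\<A>. \<psi> C = y \<odot> g"
    and rank_one: "f \<in> dual \<Longrightarrow> \<exists>a b. b \<in> dual \<and> \<psi> (x \<odot> f) = a \<odot> b"
    and add_left: "f \<in> dual \<Longrightarrow> \<psi> ((x + y) \<odot> f) = (\<lambda>u. \<psi> (x \<odot> f) u + \<psi> (y \<odot> f) u)"
    and add_right: "f \<in> dual \<Longrightarrow> h \<in> dual \<Longrightarrow>
      \<psi> (x \<odot> (\<lambda>u. f u + h u)) = (\<lambda>u. \<psi> (x \<odot> f) u + \<psi> (x \<odot> h) u)"
    and scale_left: "f \<in> dual \<Longrightarrow> \<psi> (smul c x \<odot> f) = (\<lambda>u. smul c (\<psi> (x \<odot> f) u))"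
    and zero: "\<psi> (\<lambda>_. 0) = (\<lambda>_. 0)"
    and trace: "f \<in> dual \<Longrightarrow> b \<in> dual \<Longrightarrow> \<psi> (x \<odot> f) = a \<odot> b \<Longrightarrow> b a = f x"
    and form: "f \<in> dual \<Longrightarrow> b \<in> dual \<Longrightarrow> \<psi> (x \<odot> f) = a \<odot> b \<Longrightarrow> B \<in> \<A> \<Longrightarrow> b (\<psi> B a) = f (B x)"
begin

lemma scale_right:
  assumes "f \<in> dual" shows "\<psi> (x \<odot> (\<lambda>u. c * f u)) = (\<lambda>u. smul c (\<psi> (x \<odot> f) u))"
proof -
  have "x \<odot> (\<lambda>u. c * f u) = smul c x \<odot> f" by (simp add: tensor_scale_left tensor_scale_right)
  thus ?thesis using scale_left[OF assms] by simp
qed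

lemma form_tensor:
  assumes f: "f \<in> dual" and g: "g \<in> dual" and b: "b \<in> dual" and d: "d \<in> dual"
    and eq: "\<psi> (x \<odot> f) = a \<odot> b" "\<psi> (u \<odot> g) = c \<odot> d"
  shows "b c * d a = f u * g x"
proof -
  have "b ((c \<odot> d) a) = f ((u \<odot> g) x)"
    using form[OF f b eq(1) A_tensor[OF g, of u]] eq(2) by simp
  thus ?thesis using b f by (simp add: tensor_apply dualD mult.commute)
qed

lemma preimage_zero:
  assumes B: "B \<in> \<A>" "\<And>x f. f \<in> dual \<Longrightarrow> f (B x) = 0" shows "\<psi> B = (\<lambda>_. 0)"
proof -
  have "B = (\<lambda>_. 0)"
  proof (rule ext)
    fix x show "B x = 0" by (rule dual_separates) (simp add: B(2) dualD)
  qed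
  thus ?thesis using zero by simp
qed

text \<open>Everything is read off from \<open>pre\<close>, which expresses an operator B through S
  and C whenever its image \<open>\<psi> B\<close> is a given rank one operator. As the range
  supplies every such image, S inherits surjectivity and continuity from the operators B.\<close>

lemma spatial:
  assumes x0: "(x0::'a) \<noteq> 0"
    and eq: "\<And>x f. f \<in> dual \<Longrightarrow> \<psi> (x \<odot> f) = S x \<odot> C f" and C: "\<And>f. f \<in> dual \<Longrightarrow> C f \<in> dual"
    and S_add: "\<And>x y. S (x + y) = S x + S y" and S_scale: "\<And>c x. S (smul c x) = smul c (S x)"
  shows "invertible_op smul S" and "\<And>A. A \<in> \<A> \<Longrightarrow> \<psi> A = (\<lambda>x. S (A (inv S x)))"
proof -
  obtain g where g: "g \<in> dual" "g x0 = 1" by (rule exists_dual[OF x0])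
  have CS: "C f (S x) = f x" if "f \<in> dual" for f x by (rule trace[OF that C[OF that] eq[OF that]])
  have CF: "C f (\<psi> B (S x)) = f (B x)" if "f \<in> dual" "B \<in> \<A>" for f B x
    by (rule form[OF that(1) C[OF that(1)] eq[OF that(1)] that(2)])
  have pre: "f (B x) = h (S x) * C f y" if "f \<in> dual" "B \<in> \<A>" "\<psi> B = y \<odot> h" for f B x y h
    using CF[OF that(1,2), of x] C[OF that(1)] by (simp add: that(3) tensor_apply dualD)
  \<comment> \<open>If all C f vanish at z, then by \<open>pre\<close> a preimage of
    \<open>z \<odot> g\<close> is the zero operator, so \<open>z \<odot> g\<close> is zero and z =
    0.\<close>
  have C_sep: "z = 0" if z: "\<And>f. f \<in> dual \<Longrightarrow> C f z = 0" for z
  proof -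
    obtain B where B: "B \<in> \<A>" "\<psi> B = z \<odot> g" using range[OF g(1)] by blast
    have "\<psi> B = (\<lambda>_. 0)" by (rule preimage_zero[OF B(1)]) (simp add: pre[OF _ B] z)
    hence "(z \<odot> g) x0 = 0" using B(2) by simp
    thus "z = 0" using g by (simp add: tensor_apply)
  qed
  have C_eq: "y = z" if yz: "\<And>f. f \<in> dual \<Longrightarrow> C f y = C f z" for y z
  proof -
    have "y - z = 0" by (rule C_sep) (simp add: yz C dualD(5)[OF C])
    thus ?thesis by simp
  qed
  have comm: "\<psi> A (S x) = S (A x)" if "A \<in> \<A>" for A x
    by (rule C_eq) (simp add: CF CS that)
  have "\<exists>x1. g (S x1) \<noteq> 0"
  proof (rule ccontr)
    assume no: "\<nexists>x1. g (S x1) \<noteq> 0"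
    obtain B where B: "B \<in> \<A>" "\<psi> B = x0 \<odot> g" using range[OF g(1)] by blast
    have "\<psi> B = (\<lambda>_. 0)" by (rule preimage_zero[OF B(1)]) (use no in \<open>simp add: pre[OF _ B]\<close>)
    hence "(x0 \<odot> g) x0 = 0" using B(2) by simp
    thus False using g x0 by (simp add: tensor_apply)
  qed
  then obtain x1 where x1: "g (S x1) \<noteq> 0" by blast
  have surj: "\<exists>x. y = S x" for y
  proof -
    obtain B where B: "B \<in> \<A>" "\<psi> B = y \<odot> g" using range[OF g(1)] by blast
    have "y = S (smul (1 / g (S x1)) (B x1))"
    proof (rule C_eq)
      fix f assume f: "f \<in> dual"
      show "C f y = C f (S (smul (1 / g (S x1)) (B x1)))"
        unfolding CS[OF f] dualD(3)[OF f] pre[OF f B, of x1] using x1 by simp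
    qed
    thus ?thesis by blast
  qed
  have inj: "x = y" if "S x = S y" for x y
    by (rule dual_separates) (metis CS that)
  have bij: "bij S" using surj inj by (auto simp: bij_def inj_def surj_def)
  have lin: "linear S"
    using S_add S_scale[of "complex_of_real _"] by (intro linearI) (simp_all add: smul_of_real)
  obtain K where K: "0 \<le> K" "\<And>x. norm (S x) \<le> K * norm x"
  proof (rule bounded_if_weakly_bounded[OF lin])
    fix \<rho> :: "'a \<Rightarrow> real" assume \<rho>: "bounded_linear \<rho>"
    define h where "h = (\<lambda>u. Complex (\<rho> u) (- \<rho> (smul \<i> u)))"
    have h: "h \<in> dual" unfolding h_def by (rule complexification_in_dual[OF \<rho>])
    \<comment> \<open>With h fixed and B a preimage of \<open>x0 \<odot> h\<close>,
      \<open>pre\<close> gives \<open>h (S x) = f (B x) / C f x0\<close>, which is continuous in x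
      because B is bounded.\<close>
    obtain f where f: "f \<in> dual" "C f x0 \<noteq> 0" using C_sep[of x0] x0 by blast
    obtain B where B: "B \<in> \<A>" "\<psi> B = x0 \<odot> h" using range[OF h] by blast
    have "\<rho> (S x) = Re (f (B x) / C f x0)" for x
      using pre[OF f(1) B, of x] f(2) by (simp add: h_def)
    moreover have "continuous_on UNIV (\<lambda>x. f (B x))"
      by (rule linear_continuous_on[OF dualD(1)[OF dual_comp[OF f(1) A_bop[OF B(1)]]]])
    ultimately show "continuous_on UNIV (\<lambda>x. \<rho> (S x))"
      using f(2) by (auto intro!: continuous_intros)
  qed blast
  have "bounded_linear S"
    by (rule bounded_linear_intro[of S K]) (use lin K in \<open>auto simp: linear_add linear_scale mult.commute\<close>)
  thus "invertible_op smul S" using bij S_scale by (simp add: invertible_op_def bounded_clinear_op_def)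
  fix A assume A: "A \<in> \<A>"
  show "\<psi> A = (\<lambda>x. S (A (inv S x)))"
  proof
    fix y
    have "\<psi> A (S (inv S y)) = S (A (inv S y))" by (rule comm[OF A])
    thus "\<psi> A y = S (A (inv S y))" using bij by (simp add: bij_is_surj surj_f_inv_f)
  qed
qed

text \<open>The argument of \<open>spatial\<close> with vectors and functionals exchanged;
  \<open>f \<circ> A\<close> is the adjoint of A applied to f.\<close>

lemma dual_spatial:
  assumes x0: "(x0::'a) \<noteq> 0"
    and eq: "\<And>x f. f \<in> dual \<Longrightarrow> \<psi> (x \<odot> f) = S f \<odot> C x" and C: "\<And>x. C x \<in> dual"
    and S_add: "\<And>f h. f \<in> dual \<Longrightarrow> h \<in> dual \<Longrightarrow> S (\<lambda>u. f u + h u) = S f + S h"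
    and S_scale: "\<And>c f. f \<in> dual \<Longrightarrow> S (\<lambda>u. c * f u) = smul c (S f)"
  shows "invertible_dual_op smul S"
    and "\<And>A. A \<in> \<A> \<Longrightarrow> \<psi> A = (\<lambda>x. S (inv_into dual S x \<circ> A))"
proof -
  obtain g where g: "g \<in> dual" "g x0 = 1" by (rule exists_dual[OF x0])
  have CS: "C x (S f) = f x" if "f \<in> dual" for f x by (rule trace[OF that C eq[OF that]])
  have CF: "C x (\<psi> B (S f)) = f (B x)" if "f \<in> dual" "B \<in> \<A>" for f B x
    by (rule form[OF that(1) C eq[OF that(1)] that(2)])
  have pre: "f (B x) = h (S f) * C x y" if "f \<in> dual" "B \<in> \<A>" "\<psi> B = y \<odot> h" for f B x y h
    using CF[OF that(1,2), of x] C by (simp add: that(3) tensor_apply dualD(3)[OF C])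
  have C_sep: "z = 0" if z: "\<And>x. C x z = 0" for z
  proof -
    obtain B where B: "B \<in> \<A>" "\<psi> B = z \<odot> g" using range[OF g(1)] by blast
    have "\<psi> B = (\<lambda>_. 0)" by (rule preimage_zero[OF B(1)]) (simp add: pre[OF _ B] z)
    hence "(z \<odot> g) x0 = 0" using B(2) by simp
    thus "z = 0" using g by (simp add: tensor_apply)
  qed
  have C_eq: "y = z" if yz: "\<And>x. C x y = C x z" for y z
  proof -
    have "y - z = 0" by (rule C_sep) (simp add: yz dualD(5)[OF C])
    thus ?thesis by simp
  qed
  have comp: "f \<circ> A \<in> dual" if "f \<in> dual" "A \<in> \<A>" for f A
    using dual_comp[OF that(1) A_bop[OF that(2)]] by (simp add: comp_def)
  have comm: "\<psi> A (S f) = S (f \<circ> A)" if "A \<in> \<A>" "f \<in> dual" for A f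
    by (rule C_eq) (simp add: CF CS that comp)
  have "\<exists>f1\<in>dual. g (S f1) \<noteq> 0"
  proof (rule ccontr)
    assume no: "\<not> ?thesis"
    obtain B where B: "B \<in> \<A>" "\<psi> B = x0 \<odot> g" using range[OF g(1)] by blast
    have "\<psi> B = (\<lambda>_. 0)" by (rule preimage_zero[OF B(1)]) (use no in \<open>simp add: pre[OF _ B]\<close>)
    hence "(x0 \<odot> g) x0 = 0" using B(2) by simp
    thus False using g x0 by (simp add: tensor_apply)
  qed
  then obtain f1 where f1: "f1 \<in> dual" "g (S f1) \<noteq> 0" by blast
  have surj: "y \<in> S ` dual" for y
  proof -
    obtain B where B: "B \<in> \<A>" "\<psi> B = y \<odot> g" using range[OF g(1)] by blast
    let ?f = "\<lambda>u. (1 / g (S f1)) * f1 (B u)"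
    have f: "?f \<in> dual" by (rule dual_scale[OF dual_comp[OF f1(1) A_bop[OF B(1)]]])
    have "y = S ?f"
    proof (rule C_eq)
      fix x show "C x y = C x (S ?f)"
        unfolding CS[OF f] pre[OF f1(1) B, of x] using f1(2) by simp
    qed
    thus ?thesis using f by blast
  qed
  have "inj_on S dual"
  proof (rule inj_onI)
    fix f h assume fh: "f \<in> dual" "h \<in> dual" "S f = S h"
    show "f = h" by (rule ext) (metis CS fh)
  qed
  hence bij: "bij_betw S dual UNIV" using surj by (auto simp: bij_betw_def)
  \<comment> \<open>Baire's theorem needs a Banach space type as domain, while \<open>dual\<close>
    is only a set. Real functionals form such a type, and cx passes from a real functional to the
    complex one with that real part.\<close>
  define cx where "cx \<rho> = (\<lambda>u. Complex (blinfun_apply \<rho> u) (- blinfun_apply \<rho> (smul \<i> u)))"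
    for \<rho> :: "'a \<Rightarrow>\<^sub>L real"
  have cx: "cx \<rho> \<in> dual" for \<rho>
    unfolding cx_def by (rule complexification_in_dual) (rule blinfun.bounded_linear_right)
  have lin: "linear (\<lambda>\<rho>. S (cx \<rho>))"
  proof (rule linearI)
    fix \<rho> \<sigma> :: "'a \<Rightarrow>\<^sub>L real" and t :: real
    have "cx (\<rho> + \<sigma>) = (\<lambda>u. cx \<rho> u + cx \<sigma> u)" by (auto simp: cx_def blinfun.add_left complex_eq_iff)
    thus "S (cx (\<rho> + \<sigma>)) = S (cx \<rho>) + S (cx \<sigma>)" using S_add[OF cx cx] by simp
    have "cx (t *\<^sub>R \<rho>) = (\<lambda>u. complex_of_real t * cx \<rho> u)"
      by (auto simp: cx_def blinfun.scaleR_left complex_eq_iff)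
    thus "S (cx (t *\<^sub>R \<rho>)) = t *\<^sub>R S (cx \<rho>)" using S_scale[OF cx] by (simp add: smul_of_real)
  qed
  obtain K where K: "0 \<le> K" "\<And>\<rho>. norm (S (cx \<rho>)) \<le> K * norm \<rho>"
  proof (rule bounded_if_weakly_bounded[OF lin])
    fix \<sigma> :: "'a \<Rightarrow> real" assume \<sigma>: "bounded_linear \<sigma>"
    define h where "h = (\<lambda>u. Complex (\<sigma> u) (- \<sigma> (smul \<i> u)))"
    have h: "h \<in> dual" unfolding h_def by (rule complexification_in_dual[OF \<sigma>])
    obtain x where x: "C x x0 \<noteq> 0" using C_sep[of x0] x0 by blast
    obtain B where B: "B \<in> \<A>" "\<psi> B = x0 \<odot> h" using range[OF h] by blast
    have "\<sigma> (S (cx \<rho>)) = Re (cx \<rho> (B x) / C x x0)" for \<rho>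
      using pre[OF cx B, of \<rho> x] x by (simp add: h_def)
    moreover have "continuous_on UNIV (\<lambda>\<rho>. blinfun_apply \<rho> u)" for u :: 'a
      by (rule linear_continuous_on) (rule blinfun.bounded_linear_left)
    hence "continuous_on UNIV (\<lambda>\<rho>. cx \<rho> (B x))"
      unfolding cx_def Complex_eq by (intro continuous_intros)
    ultimately show "continuous_on UNIV (\<lambda>\<rho>. \<sigma> (S (cx \<rho>)))"
      using x by (auto intro!: continuous_intros)
  qed blast
  have "norm (S f) \<le> K * onorm f" if f: "f \<in> dual" for f
  proof -
    note bl = dualD(1)[OF f]
    have re: "bounded_linear (\<lambda>u. Re (f u))" by (rule bounded_linear_compose[OF bounded_linear_Re bl])
    define \<rho> where "\<rho> = Blinfun (\<lambda>u. Re (f u))"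
    have app: "blinfun_apply \<rho> = (\<lambda>u. Re (f u))" unfolding \<rho>_def by (rule bounded_linear_Blinfun_apply[OF re])
    have "cx \<rho> = f" using f by (auto simp: cx_def app dualD complex_eq_iff)
    moreover have "norm \<rho> \<le> onorm f"
      unfolding norm_blinfun.rep_eq app
    proof (rule onorm_bound[OF onorm_pos_le[OF bl]])
      fix u show "norm (Re (f u)) \<le> onorm f * norm u"
        using order_trans[OF abs_Re_le_cmod onorm[OF bl]] by simp
    qed
    ultimately show ?thesis using K(2)[of \<rho>] mult_left_mono[OF _ K(1)] by (metis order_trans)
  qed
  thus "invertible_dual_op smul S" using bij S_add S_scale by (auto simp: invertible_dual_op_def)
  fix A assume A: "A \<in> \<A>"
  show "\<psi> A = (\<lambda>x. S (inv_into dual S x \<circ> A))"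
  proof
    fix y
    have "\<psi> A (S (inv_into dual S y)) = S (inv_into dual S y \<circ> A)"
      by (rule comm[OF A]) (rule inv_into_into[OF surj])
    thus "\<psi> A y = S (inv_into dual S y \<circ> A)" by (simp add: f_inv_into_f[OF surj])
  qed
qed

theorem spatial_or_dual_spatial:
  assumes x0: "(x0::'a) \<noteq> 0"
  shows "(\<exists>S. invertible_op smul S \<and> (\<forall>A\<in>\<A>. \<psi> A = (\<lambda>x. S (A (inv S x))))) \<or>
    (\<exists>S. invertible_dual_op smul S \<and> (\<forall>A\<in>\<A>. \<psi> A = (\<lambda>x. S (inv_into dual S x \<circ> A))))"
proof -
  obtain f0 where f0: "f0 \<in> dual" "f0 x0 = 1" by (rule exists_dual[OF x0])
  obtain y0 g0 where base: "g0 \<in> dual" "\<psi> (x0 \<odot> f0) = y0 \<odot> g0" using rank_one[OF f0(1)] by blast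
  have g0: "g0 y0 = 1" using trace[OF f0(1) base] f0(2) by simp
  have y0: "y0 \<noteq> 0" using g0 dualD(4)[OF base(1)] by auto
  have bop\<psi>: "bop (\<psi> (x \<odot> f))" if "f \<in> dual" for x f by (intro A_bop maps A_tensor that)
  \<comment> \<open>An operator whose sum with \<open>y0 \<odot> g0\<close> still has rank at most
    one shares the functional g0 or the vector y0 with it.\<close>
  have dich: "(\<exists>p. T = p \<odot> g0) \<or> (\<exists>q. q \<in> dual \<and> T = y0 \<odot> q)"
    if "d \<in> dual" "T = c \<odot> d" "h \<in> dual" "\<And>v. (y0 \<odot> g0) v + (c \<odot> d) v = (e \<odot> h) v" for T c d e h
  proof -
    have "(\<exists>t. c = smul t y0) \<or> (\<exists>t. d = (\<lambda>u. t * g0 u))"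
      using tensor_add_dichotomy[OF base(1) that(1,3) _ y0 that(4), of y0] g0 by simp
    thus ?thesis
    proof (elim disjE exE)
      fix t assume "c = smul t y0"
      hence "T = y0 \<odot> (\<lambda>u. t * d u)" using that(2) by (simp add: tensor_scale_left tensor_scale_right)
      thus ?thesis using dual_scale[OF that(1)] by blast
    next
      fix t assume "d = (\<lambda>u. t * g0 u)"
      hence "T = smul t c \<odot> g0" using that(2) by (simp add: tensor_scale_left tensor_scale_right)
      thus ?thesis by blast
    qed
  qed
  have row: "(\<exists>p. \<psi> (x \<odot> f0) = p \<odot> g0) \<or> (\<exists>q. q \<in> dual \<and> \<psi> (x \<odot> f0) = y0 \<odot> q)" for x
  proof -
    obtain c d where cd: "d \<in> dual" "\<psi> (x \<odot> f0) = c \<odot> d" using rank_one[OF f0(1)] by blast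
    obtain e h where eh: "h \<in> dual" "\<psi> ((x0 + x) \<odot> f0) = e \<odot> h" using rank_one[OF f0(1)] by blast
    show ?thesis
      by (rule dich[OF cd eh(1), of e]) (use fun_cong[OF add_left[OF f0(1), of x0 x]] in \<open>simp add: base(2) cd(2) eh(2)\<close>)
  qed
  \<comment> \<open>The alternative is the same for all x: if x1 and x2 violated different ones, the
    image of their sum would have rank two. The choice made here separates the form with A from the
    form with its adjoint.\<close>
  have "(\<forall>x. \<exists>p. \<psi> (x \<odot> f0) = p \<odot> g0) \<or> (\<forall>x. \<exists>q. q \<in> dual \<and> \<psi> (x \<odot> f0) = y0 \<odot> q)"
  proof (rule ccontr)
    assume "\<not> ?thesis"
    then obtain x1 x2 where x1: "\<nexists>p. \<psi> (x1 \<odot> f0) = p \<odot> g0"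
      and x2: "\<nexists>q. q \<in> dual \<and> \<psi> (x2 \<odot> f0) = y0 \<odot> q" by blast
    obtain q where q: "q \<in> dual" "\<psi> (x1 \<odot> f0) = y0 \<odot> q" using row[of x1] x1 by blast
    obtain p where p: "\<psi> (x2 \<odot> f0) = p \<odot> g0" using row[of x2] x2 by blast
    obtain e h where eh: "h \<in> dual" "\<psi> ((x1 + x2) \<odot> f0) = e \<odot> h" using rank_one[OF f0(1)] by blast
    have sum: "(y0 \<odot> q) v + (p \<odot> g0) v = (e \<odot> h) v" for v
      using fun_cong[OF add_left[OF f0(1), of x1 x2], of v] by (simp add: p q(2) eh(2))
    have "\<exists>v. q v \<noteq> 0"
    proof (rule ccontr)
      assume "\<nexists>v. q v \<noteq> 0"
      hence "\<psi> (x1 \<odot> f0) = 0 \<odot> g0" using q(2) by (simp add: tensor_def)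
      thus False using x1 by blast
    qed
    then obtain v where v: "q v \<noteq> 0" by blast
    have "(\<exists>t. p = smul t y0) \<or> (\<exists>t. g0 = (\<lambda>u. t * q u))"
      by (rule tensor_add_dichotomy[OF q(1) base(1) eh(1) v y0 sum])
    thus False
    proof (elim disjE exE)
      fix t assume "p = smul t y0"
      hence "\<psi> (x2 \<odot> f0) = y0 \<odot> (\<lambda>u. t * g0 u)" using p by (simp add: tensor_scale_left tensor_scale_right)
      thus False using x2 dual_scale[OF base(1)] by blast
    next
      fix t assume t: "g0 = (\<lambda>u. t * q u)"
      hence "t \<noteq> 0" using g0 by auto
      hence "\<psi> (x1 \<odot> f0) = smul (1 / t) y0 \<odot> g0" using q(2) t by (simp add: tensor_def)
      thus False using x1 by blast
    qed
  qed
  thus ?thesis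
  proof
    assume A: "\<forall>x. \<exists>p. \<psi> (x \<odot> f0) = p \<odot> g0"
    define S where "S x = \<psi> (x \<odot> f0) y0" for x
    define C where "C f = (\<lambda>v. g0 (\<psi> (x0 \<odot> f) v))" for f
    have eq: "\<psi> (x \<odot> f) = S x \<odot> C f" if "f \<in> dual" for x f
      unfolding S_def C_def
    proof (rule rank_one_bilinear_structure[where \<beta> = "\<lambda>x f. \<psi> (x \<odot> f)" and X = UNIV and Y = dual
          and pair = "\<lambda>x f. f x" and px = "\<lambda>x. x0 + x" and py = "\<lambda>f u. f0 u + f u"])
      fix x y :: 'a and f g b d :: "'a \<Rightarrow> complex" and a c v and t :: complex
      assume f: "f \<in> dual"
      show "(\<lambda>u. f0 u + f u) \<in> dual" by (rule dual_add[OF f0(1) f])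
      show "f (x0 + x) = f x0 + f x" by (rule dualD(2)[OF f])
      show "\<psi> ((x0 + x) \<odot> f) v = \<psi> (x0 \<odot> f) v + \<psi> (x \<odot> f) v" by (simp add: add_left[OF f])
      show "\<psi> (x \<odot> (\<lambda>u. f0 u + f u)) v = \<psi> (x \<odot> f0) v + \<psi> (x \<odot> f) v"
        by (simp add: add_right[OF f0(1) f])
      show "\<exists>a b. b \<in> dual \<and> \<psi> (x \<odot> f) = a \<odot> b" by (rule rank_one[OF f])
      { assume "g \<in> dual" "b \<in> dual" "d \<in> dual" "\<psi> (x \<odot> f) = a \<odot> b" "\<psi> (y \<odot> g) = c \<odot> d"
        thus "b c * d a = f y * g x" by (rule form_tensor[OF f]) }
      { assume "b \<in> dual" "\<psi> (x \<odot> f) = a \<odot> b"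
        thus "b a = f x" by (rule trace[OF f]) }
      { assume t: "\<And>g. g \<in> dual \<Longrightarrow> g x = t * g x0"
        have "x = smul t x0" by (rule dual_separates) (simp add: t dualD)
        thus "\<psi> (x \<odot> f) = (\<lambda>v. smul t (\<psi> (x0 \<odot> f) v))" by (simp add: scale_left[OF f]) }
      { assume "\<And>u. u \<in> UNIV \<Longrightarrow> f u = t * f0 u"
        hence "f = (\<lambda>u. t * f0 u)" by auto
        thus "\<psi> (x \<odot> f) = (\<lambda>v. smul t (\<psi> (x \<odot> f0) v))" by (simp add: scale_right[OF f0(1)]) }
    qed (use that f0 base g0 A in auto)
    have C: "C f \<in> dual" if "f \<in> dual" for f
      unfolding C_def by (rule dual_comp[OF base(1) bop\<psi>[OF that]])
    have S: "S (x + y) = S x + S y" "S (smul c x) = smul c (S x)" for x y c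
      by (simp_all add: S_def add_left[OF f0(1)] scale_left[OF f0(1)])
    show ?thesis
    proof (intro disjI1 exI conjI ballI)
      show "invertible_op smul S" by (rule spatial(1)[OF x0 eq C S])
      show "\<psi> A = (\<lambda>x. S (A (inv S x)))" if "A \<in> \<A>" for A by (rule spatial(2)[OF x0 eq C S that])
    qed
  next
    assume B: "\<forall>x. \<exists>q. q \<in> dual \<and> \<psi> (x \<odot> f0) = y0 \<odot> q"
    \<comment> \<open>The row condition for the exchanged roles. If
      \<open>\<psi> (x0 \<odot> f)\<close> shared only y0 with the base, then, every
      \<open>\<psi> (x \<odot> f0)\<close> doing so as well, \<open>form_tensor\<close> would make f
      a multiple of f0.\<close>
    have row': "\<exists>p. \<psi> (x0 \<odot> f) = p \<odot> g0" if f: "f \<in> dual" for f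
    proof -
      obtain c d where cd: "d \<in> dual" "\<psi> (x0 \<odot> f) = c \<odot> d" using rank_one[OF f] by blast
      obtain e h where eh: "h \<in> dual" "\<psi> (x0 \<odot> (\<lambda>u. f0 u + f u)) = e \<odot> h"
        using rank_one[OF dual_add[OF f0(1) f]] by blast
      have "(\<exists>p. \<psi> (x0 \<odot> f) = p \<odot> g0) \<or> (\<exists>q. q \<in> dual \<and> \<psi> (x0 \<odot> f) = y0 \<odot> q)"
        by (rule dich[OF cd eh(1), of e])
          (use fun_cong[OF add_right[OF f0(1) f, of x0]] in \<open>simp add: base(2) cd(2) eh(2)\<close>)
      thus ?thesis
      proof (elim disjE exE conjE)
        fix q assume q: "q \<in> dual" "\<psi> (x0 \<odot> f) = y0 \<odot> q"
        have "f x = f x0 * f0 x" for x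
        proof -
          obtain qx where qx: "qx \<in> dual" "\<psi> (x \<odot> f0) = y0 \<odot> qx" using B by blast
          have "qx y0 * q y0 = f0 x0 * f x" by (rule form_tensor[OF f0(1) f qx(1) q(1) qx(2) q(2)])
          thus ?thesis using trace[OF f0(1) qx] trace[OF f q] f0(2) by (simp add: mult.commute)
        qed
        hence "f = (\<lambda>u. f x0 * f0 u)" by blast
        hence "\<psi> (x0 \<odot> f) = (\<lambda>u. smul (f x0) (\<psi> (x0 \<odot> f0) u))"
          using scale_right[OF f0(1), of x0 "f x0"] by metis
        hence "\<psi> (x0 \<odot> f) = smul (f x0) y0 \<odot> g0" by (simp add: base(2) tensor_scale_left)
        thus ?thesis by blast
      qed blast
    qed
    define S where "S f = \<psi> (x0 \<odot> f) y0" for f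
    define C where "C x = (\<lambda>v. g0 (\<psi> (x \<odot> f0) v))" for x
    have eq: "\<psi> (x \<odot> f) = S f \<odot> C x" if "f \<in> dual" for x f
      unfolding S_def C_def
    proof (rule rank_one_bilinear_structure[where \<beta> = "\<lambda>f x. \<psi> (x \<odot> f)" and Y = UNIV and X = dual
          and pair = "\<lambda>f x. f x" and py = "\<lambda>x. x0 + x" and px = "\<lambda>f u. f0 u + f u"])
      fix x y :: 'a and f g b d :: "'a \<Rightarrow> complex" and a c v and t :: complex
      assume f: "f \<in> dual"
      show "(\<lambda>u. f0 u + f u) \<in> dual" by (rule dual_add[OF f0(1) f])
      show "f (x0 + x) = f x0 + f x" by (rule dualD(2)[OF f])
      show "\<psi> ((x0 + x) \<odot> f) v = \<psi> (x0 \<odot> f) v + \<psi> (x \<odot> f) v" by (simp add: add_left[OF f])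
      show "\<psi> (x \<odot> (\<lambda>u. f0 u + f u)) v = \<psi> (x \<odot> f0) v + \<psi> (x \<odot> f) v"
        by (simp add: add_right[OF f0(1) f])
      show "\<exists>a b. b \<in> dual \<and> \<psi> (x \<odot> f) = a \<odot> b" by (rule rank_one[OF f])
      { assume g: "g \<in> dual" "b \<in> dual" "d \<in> dual" "\<psi> (x \<odot> f) = a \<odot> b" "\<psi> (y \<odot> g) = c \<odot> d"
        have "b c * d a = f y * g x" by (rule form_tensor[OF f g])
        thus "b c * d a = g x * f y" by simp }
      { assume "b \<in> dual" "\<psi> (x \<odot> f) = a \<odot> b"
        thus "b a = f x" by (rule trace[OF f]) }
      { assume t: "\<And>g. g \<in> dual \<Longrightarrow> g x = t * g x0"
        have "x = smul t x0" by (rule dual_separates) (simp add: t dualD)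
        thus "\<psi> (x \<odot> f) = (\<lambda>v. smul t (\<psi> (x0 \<odot> f) v))" by (simp add: scale_left[OF f]) }
      { assume "\<And>u. u \<in> UNIV \<Longrightarrow> f u = t * f0 u"
        hence "f = (\<lambda>u. t * f0 u)" by auto
        thus "\<psi> (x \<odot> f) = (\<lambda>v. smul t (\<psi> (x \<odot> f0) v))" by (simp add: scale_right[OF f0(1)]) }
      show "\<exists>p. \<psi> (x0 \<odot> f) = p \<odot> g0" by (rule row'[OF f])
    qed (use that f0 base g0 in auto)
    have C: "C x \<in> dual" for x
      unfolding C_def by (rule dual_comp[OF base(1) bop\<psi>[OF f0(1)]])
    have S_add: "S (\<lambda>u. f u + h u) = S f + S h" if "f \<in> dual" "h \<in> dual" for f h
      by (simp add: S_def add_right[OF that])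
    have S_scale: "S (\<lambda>u. c * f u) = smul c (S f)" if "f \<in> dual" for c f
      by (simp add: S_def scale_right[OF that])
    show ?thesis
    proof (intro disjI2 exI conjI ballI)
      show "invertible_dual_op smul S" by (rule dual_spatial(1)[OF x0 eq C S_add S_scale])
      show "\<psi> A = (\<lambda>x. S (inv_into dual S x \<circ> A))" if "A \<in> \<A>" for A
        by (rule dual_spatial(2)[OF x0 eq C S_add S_scale that])
    qed
  qed
qed

end

section \<open>Division by the root of unity\<close>

context product_preserver
begin

lemma normalized_trace_form_preserver:
  assumes \<xi>: "\<xi> ^ (n + 2) = 1" and tr: "\<And>x f. f \<in> dual \<Longrightarrow> image_tr x f = \<xi> * f x"
  shows "trace_form_preserver smul \<A> (\<lambda>A u. smul (1 / \<xi>) (\<phi> A u))"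
proof -
  define \<psi> where "\<psi> = (\<lambda>A u. smul (1 / \<xi>) (\<phi> A u))"
  have \<xi>0: "\<xi> \<noteq> 0" using \<xi> by auto
  have \<psi>_tensor: "\<psi> (x \<odot> f) = smul (1 / \<xi>) a \<odot> b" if "\<phi> (x \<odot> f) = a \<odot> b" for x f a b
    by (simp add: \<psi>_def that tensor_scale_left)
  have \<psi>_add: "\<psi> ((x + y) \<odot> f) = (\<lambda>u. \<psi> (x \<odot> f) u + \<psi> (y \<odot> f) u)" if "f \<in> dual" for x y f
    by (simp add: \<psi>_def \<phi>_add_left[OF that] cv.scale_right_distrib)
  have \<psi>_bop: "bop (\<psi> B)" if "B \<in> \<A>" for B unfolding \<psi>_def by (rule bop_scale[OF \<phi>_bop[OF that]])
  have rank: "\<exists>a b. b \<in> dual \<and> \<psi> (x \<odot> f) = a \<odot> b" if "f \<in> dual" for x f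
    by (rule image_rank_one[OF that, of x]) (use \<psi>_tensor in blast)
  have form_nz: "b (\<psi> B a) = f (B x)"
    if f: "f \<in> dual" and b: "b \<in> dual" and eq: "\<psi> (x \<odot> f) = a \<odot> b" and B: "B \<in> \<A>" and nz: "f x \<noteq> 0" for x f a b B
  proof -
    obtain a' b' where ab': "b' \<in> dual" "\<phi> (x \<odot> f) = a' \<odot> b'" by (rule image_rank_one[OF f])
    have "b' a' = \<xi> * f x" using image_tr[OF ab'] tr[OF f] by simp
    hence "(\<xi> * f x) ^ n * b' (\<phi> B a') = f x ^ n * f (B x)" using tensor_trace[OF f ab' B] by simp
    hence 1: "\<xi> ^ n * b' (\<phi> B a') = f (B x)" using nz by (simp add: power_mult_distrib)
    \<comment> \<open>The given a, b and the chosen a', b' may differ by scalars; composing with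
      \<open>\<psi> B\<close> and taking traces gives a value independent of that choice.\<close>
    have "a \<odot> (\<lambda>u. b (\<psi> B u)) = smul (1 / \<xi>) a' \<odot> (\<lambda>u. b' (\<psi> B u))"
      using eq \<psi>_tensor[OF ab'(2)] by (simp add: tensor_def fun_eq_iff)
    hence "b (\<psi> B a) = b' (\<psi> B (smul (1 / \<xi>) a'))"
      by (rule trace_unique[OF dual_comp[OF b \<psi>_bop[OF B]] dual_comp[OF ab'(1) \<psi>_bop[OF B]]])
    also have "\<dots> = b' (\<phi> B a') / \<xi> ^ 2"
      using ab'(1) \<phi>_bop[OF B] by (simp add: \<psi>_def bopD dualD power2_eq_square)
    \<comment> \<open>Two factors \<open>1 / \<xi>\<close> arise, one from each image; they give
      \<open>\<xi>^n\<close> because \<open>\<xi>^(n+2) = 1\<close>.\<close>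
    also have "\<dots> = \<xi> ^ n * b' (\<phi> B a')" using \<xi> \<xi>0 by (simp add: power_add power2_eq_square field_simps)
    finally show ?thesis using 1 by simp
  qed
  have form: "b (\<psi> B a) = f (B x)"
    if f: "f \<in> dual" and b: "b \<in> dual" and eq: "\<psi> (x \<odot> f) = a \<odot> b" and B: "B \<in> \<A>" for x f a b B
  proof (cases "f x = 0")
    case False thus ?thesis using form_nz[OF f b eq B] by blast
  next
    case fx: True
    note comp = dual_comp[OF _ \<psi>_bop[OF B]]
    show ?thesis
    proof (cases "\<exists>u. f u \<noteq> 0")
      case False
      hence "x \<odot> f = (\<lambda>_. 0)" by (simp add: tensor_def)
      hence "a \<odot> b = (\<lambda>_. 0)" using eq \<phi>_zero by (simp add: \<psi>_def)
      hence "a \<odot> (\<lambda>u. b (\<psi> B u)) = 0 \<odot> (\<lambda>u. 0)" by (auto simp: tensor_def fun_eq_iff)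
      from trace_unique[OF comp[OF b] dual_zero this] show ?thesis using False by simp
    next
      case True
      \<comment> \<open>Where the trace of \<open>x \<odot> f\<close> is zero,
        \<open>tensor_trace\<close> can degenerate to 0 = 0. The identity is then obtained as the
        difference of those for x + u and u.\<close>
      then obtain u where u: "f u \<noteq> 0" by blast
      obtain a1 b1 where 1: "b1 \<in> dual" "\<psi> (u \<odot> f) = a1 \<odot> b1" using rank[OF f] by blast
      obtain a2 b2 where 2: "b2 \<in> dual" "\<psi> ((x + u) \<odot> f) = a2 \<odot> b2" using rank[OF f] by blast
      have "b1 (\<psi> B a1) = f (B u)" by (rule form_nz[OF f 1 B u])
      moreover have "b2 (\<psi> B a2) = f (B (x + u))" by (rule form_nz[OF f 2 B]) (use fx u f in \<open>simp add: dualD\<close>)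
      moreover have "b (\<psi> B a) + b1 (\<psi> B a1) = b2 (\<psi> B a2) + 0"
        by (rule trace_unique2[OF comp[OF b] comp[OF 1(1)] comp[OF 2(1)] dual_zero, where ?x4.0 = 0])
          (use fun_cong[OF \<psi>_add[OF f, of x u, unfolded eq 1(2) 2(2)]] in \<open>simp add: tensor_apply\<close>)
      ultimately show ?thesis using f A_bop[OF B] by (simp add: dualD bopD)
    qed
  qed
  have "trace_form_preserver smul \<A> \<psi>"
  proof
    fix f h b :: "'a \<Rightarrow> complex" and x y a :: 'a and c and A
    show "\<psi> (\<lambda>_. 0) = (\<lambda>_. 0)" by (simp add: \<psi>_def \<phi>_zero)
    show "\<psi> A \<in> \<A>" if "A \<in> \<A>" unfolding \<psi>_def by (rule A_scale[OF maps[OF that]])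
    assume f: "f \<in> dual"
    obtain C where C: "C \<in> \<A>" "\<phi> C = smul \<xi> y \<odot> f" by (rule tensor_in_range[OF f])
    have "\<psi> C = y \<odot> f" using \<xi>0 by (simp add: \<psi>_def C(2) tensor_def)
    thus "\<exists>C\<in>\<A>. \<psi> C = y \<odot> f" using C(1) by blast
    show "\<exists>a b. b \<in> dual \<and> \<psi> (x \<odot> f) = a \<odot> b" by (rule rank[OF f])
    show "\<psi> ((x + y) \<odot> f) = (\<lambda>u. \<psi> (x \<odot> f) u + \<psi> (y \<odot> f) u)" by (rule \<psi>_add[OF f])
    show "\<psi> (smul c x \<odot> f) = (\<lambda>u. smul c (\<psi> (x \<odot> f) u))"
      by (simp add: \<psi>_def \<phi>_scale_left[OF f] mult.commute)
    show "\<psi> (x \<odot> (\<lambda>u. f u + h u)) = (\<lambda>u. \<psi> (x \<odot> f) u + \<psi> (x \<odot> h) u)" if "h \<in> dual"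
      by (simp add: \<psi>_def \<phi>_add_right[OF f that] cv.scale_right_distrib)
    assume b: "b \<in> dual" and eq: "\<psi> (x \<odot> f) = a \<odot> b"
    show "b (\<psi> B a) = f (B x)" if "B \<in> \<A>" for B by (rule form[OF f b eq that])
    have "\<phi> (x \<odot> f) = smul \<xi> a \<odot> b"
      using arg_cong[OF eq, of "\<lambda>T u. smul \<xi> (T u)"] \<xi>0 by (simp add: \<psi>_def tensor_scale_left)
    from image_tr[OF b this] tr[OF f] show "b a = f x" using b \<xi>0 by (simp add: dualD)
  qed
  thus ?thesis by (simp add: \<psi>_def)
qed

theorem spatial_up_to_scalar:
  "\<exists>\<xi>::complex. \<xi> ^ (n + 2) = 1 \<and>
     ((\<exists>S. invertible_op smul S \<and> (\<forall>A\<in>\<A>. \<phi> A = (\<lambda>x. smul \<xi> (S (A (inv S x)))))) \<or>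
      (\<exists>S. invertible_dual_op smul S \<and> (\<forall>A\<in>\<A>. \<phi> A = (\<lambda>x. smul \<xi> (S (inv_into dual S x \<circ> A))))))"
proof (cases "\<exists>x0::'a. x0 \<noteq> 0")
  \<comment> \<open>On the zero space there is no base vector, but any two maps agree, so
    \<open>\<xi>\<close> = 1 and the identity work.\<close>
  case False
  hence all: "x = y" for x y :: 'a by metis
  have "invertible_op smul id"
    unfolding invertible_op_def bounded_clinear_op_def using bij_id by (simp add: bounded_linear_ident id_def)
  moreover have "\<phi> A = (\<lambda>x. smul 1 (id (A (inv id x))))" for A by (rule ext) (rule all)
  ultimately show ?thesis by (intro exI[of _ 1] conjI disjI1 exI[of _ id]) auto
next
  case True
  then obtain x0 :: 'a where x0: "x0 \<noteq> 0" by blast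
  obtain \<xi> where \<xi>: "\<xi> ^ (n + 2) = 1" "\<And>x f. f \<in> dual \<Longrightarrow> image_tr x f = \<xi> * f x"
    using image_tr_const[OF x0] by blast
  have \<xi>0: "\<xi> \<noteq> 0" using \<xi>(1) by auto
  interpret tf: trace_form_preserver smul \<A> "\<lambda>A u. smul (1 / \<xi>) (\<phi> A u)"
    by (rule normalized_trace_form_preserver[OF \<xi>])
  have \<phi>: "\<phi> A = (\<lambda>x. smul \<xi> (G x))" if "(\<lambda>u. smul (1 / \<xi>) (\<phi> A u)) = G" for A G
    using arg_cong[OF that, of "\<lambda>T u. smul \<xi> (T u)"] \<xi>0 by simp
  from tf.spatial_or_dual_spatial[OF x0] show ?thesis
  proof (elim disjE exE conjE)
    fix S assume "invertible_op smul S" and "\<forall>A\<in>\<A>. (\<lambda>u. smul (1 / \<xi>) (\<phi> A u)) = (\<lambda>x. S (A (inv S x)))"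
    hence "\<forall>A\<in>\<A>. \<phi> A = (\<lambda>x. smul \<xi> (S (A (inv S x))))" using \<phi> by blast
    with \<open>invertible_op smul S\<close> \<xi>(1) show ?thesis by blast
  next
    fix S assume "invertible_dual_op smul S"
      and "\<forall>A\<in>\<A>. (\<lambda>u. smul (1 / \<xi>) (\<phi> A u)) = (\<lambda>x. S (inv_into dual S x \<circ> A))"
    hence "\<forall>A\<in>\<A>. \<phi> A = (\<lambda>x. smul \<xi> (S (inv_into dual S x \<circ> A)))" using \<phi> by blast
    with \<open>invertible_dual_op smul S\<close> \<xi>(1) show ?thesis by blast
  qed
qed

end

section \<open>Specializing the generalized products to two variables\<close>

lemma gen_prod_replicate:
  assumes "\<And>j. j \<in> set xs \<Longrightarrow> a j = A"
  shows "gen_prod (xs @ ys) a = A ^^ length xs \<circ> gen_prod ys a"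
  using assms by (induction xs) (auto simp: gen_prod_def comp_assoc)

text \<open>G is the identity or \<open>\<phi>\<close>, so one statement evaluates both sides of the
  hypothesis; it is applied to the reversed sequence too.\<close>

lemma gen_prod_two_variables:
  assumes "p \<notin> set xs" "p \<notin> set ys"
  shows "gen_prod (xs @ p # ys) (\<lambda>j. G (if j = p then B else A)) = G A ^^ length xs \<circ> G B \<circ> G A ^^ length ys"
proof -
  let ?a = "\<lambda>j. G (if j = p then B else A)"
  have "gen_prod (xs @ p # ys) ?a = G A ^^ length xs \<circ> gen_prod (p # ys) ?a"
    using assms by (intro gen_prod_replicate) auto
  moreover have "gen_prod (p # ys) ?a = G B \<circ> gen_prod (ys @ []) ?a" by (simp add: gen_prod_def)
  moreover have "gen_prod (ys @ []) ?a = G A ^^ length ys \<circ> gen_prod [] ?a"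
    using assms by (intro gen_prod_replicate) auto
  ultimately show ?thesis by (simp add: gen_prod_def comp_assoc)
qed

theorem theorem2p4:
  fixes smul :: "complex \<Rightarrow> 'a::banach \<Rightarrow> 'a"
    and \<A> :: "('a \<Rightarrow> 'a) set"
    and "is" :: "nat list" and k :: nat
    and \<phi> :: "('a \<Rightarrow> 'a) \<Rightarrow> ('a \<Rightarrow> 'a)"
  assumes cb: "complex_banach_scaling smul"
    and soa: "standard_operator_algebra smul \<A>"
    and k2: "k \<ge> 2"
    and idx: "set is = {1..k}"
    and once: "\<exists>p<length is. length (filter (\<lambda>j. j = is ! p) is) = 1"
    and maps: "\<forall>A\<in>\<A>. \<phi> A \<in> \<A>"
    and hyp:
      "({T. bounded_clinear_op smul T \<and> rank_le smul T 2} \<subseteq> \<phi> ` \<A> \<and>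
        (\<forall>a. (\<forall>j\<in>{1..k}. a j \<in> \<A>) \<and> (\<exists>j\<in>{1..k}. rank_le smul (a j) 1) \<longrightarrow>
          (\<exists>\<theta>. algebra_automorphism smul \<A> \<theta> \<and>
                gen_prod is (\<lambda>j. \<phi> (a j)) = \<theta> (gen_prod is a))))
       \<or>
       ({T. bounded_clinear_op smul T \<and> rank_le smul T 3} \<subseteq> \<phi> ` \<A> \<and>
        (\<forall>a. (\<forall>j\<in>{1..k}. a j \<in> \<A>) \<and> (\<exists>j\<in>{1..k}. rank_le smul (a j) 1) \<longrightarrow>
          (\<exists>\<theta>. jordan_automorphism smul \<A> \<theta> \<and>
                gen_jordan_prod is (\<lambda>j. \<phi> (a j)) = \<theta> (gen_jordan_prod is a))))"
  shows "\<exists>\<xi>::complex. \<xi> ^ length is = 1 \<and>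
     ((\<exists>S. invertible_op smul S \<and>
          (\<forall>A\<in>\<A>. \<phi> A = (\<lambda>x. smul \<xi> (S (A (inv S x)))))) \<or>
      (\<exists>S. invertible_dual_op smul S \<and>
          (\<forall>A\<in>\<A>. \<phi> A = (\<lambda>x. smul \<xi> (S ((inv_into (cdual smul) S x) \<circ> A))))))"
proof -
  interpret standard_algebra smul \<A> by unfold_locales (rule cb, rule soa)
  obtain i where i: "i < length is" "length (filter (\<lambda>j. j = is ! i) is) = 1" using once by blast
  define p xs ys where "p = is ! i" and "xs = take i is" and "ys = drop (Suc i) is"
  have is_eq: "is = xs @ p # ys" using id_take_nth_drop[OF i(1)] by (simp add: p_def xs_def ys_def)
  have "length (filter (\<lambda>j. j = p) (xs @ p # ys)) = 1" using i(2) by (simp only: p_def[symmetric] is_eq[symmetric])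
  hence notin: "p \<notin> set xs" "p \<notin> set ys" by (auto simp: filter_empty_conv)
  have "card (set is) \<le> length is" by (rule card_length)
  hence "length is \<ge> 2" using k2 by (simp add: idx)
  \<comment> \<open>r and s count the factors on either side of the single occurrence of p, and n +
    2 is the length m; as k is at least 2, the subtraction is exact.\<close>
  define r s n where "r = length xs" and "s = length ys" and "n = length is - 2"
  have len: "length is = n + 2" using \<open>length is \<ge> 2\<close> by (simp add: n_def)
  have rs: "r + s = Suc n" using len is_eq by (simp add: r_def s_def)
  interpret pair_map smul \<A> \<phi> r s n by unfold_locales (use maps rs in auto)
  have p: "p \<in> {1..k}" using is_eq idx by (metis in_set_conv_decomp)
  \<comment> \<open>An index other than p makes A an actual argument, so that the hypothesis applies
    when A is the rank one operator.\<close>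
  have "card ({1..k} - {p}) \<noteq> 0" using k2 p by simp
  then obtain q where q: "q \<in> {1..k}" "q \<noteq> p" by (metis Diff_iff card.empty ex_in_conv singletonI)
  define sub :: "('a \<Rightarrow> 'a) \<Rightarrow> ('a \<Rightarrow> 'a) \<Rightarrow> nat \<Rightarrow> 'a \<Rightarrow> 'a" where "sub A B = (\<lambda>j. if j = p then B else A)" for A B
  have sub: "(\<forall>j\<in>{1..k}. sub A B j \<in> \<A>) \<and> (\<exists>j\<in>{1..k}. rank_le smul (sub A B j) 1)"
    if "A \<in> \<A>" "B \<in> \<A>" "rank_one A \<or> rank_one B" for A B
  proof
    show "\<forall>j\<in>{1..k}. sub A B j \<in> \<A>" using that by (simp add: sub_def)
    have "rank_le smul A 1 \<or> rank_le smul B 1" using that(3) rank_le_tensor by (auto simp: rank_one_def)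
    thus "\<exists>j\<in>{1..k}. rank_le smul (sub A B j) 1"
    proof
      assume "rank_le smul A 1" thus ?thesis using q by (intro bexI[of _ q]) (auto simp: sub_def)
    next
      assume "rank_le smul B 1" thus ?thesis using p by (intro bexI[of _ p]) (auto simp: sub_def)
    qed
  qed
  have notin': "p \<notin> set (rev ys)" "p \<notin> set (rev xs)" using notin by simp_all
  have prod: "gen_prod is (sub A B) = A ^^ r \<circ> B \<circ> A ^^ s"
      "gen_prod is (\<lambda>j. \<phi> (sub A B j)) = \<phi> A ^^ r \<circ> \<phi> B \<circ> \<phi> A ^^ s"
      "gen_prod (rev is) (sub A B) = A ^^ s \<circ> B \<circ> A ^^ r"
      "gen_prod (rev is) (\<lambda>j. \<phi> (sub A B j)) = \<phi> A ^^ s \<circ> \<phi> B \<circ> \<phi> A ^^ r" for A B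
    using gen_prod_two_variables[OF notin, of "\<lambda>T. T" B A] gen_prod_two_variables[OF notin, of \<phi> B A]
      gen_prod_two_variables[OF notin', of "\<lambda>T. T" B A] gen_prod_two_variables[OF notin', of \<phi> B A]
    by (simp_all add: is_eq sub_def r_def s_def)
  have range2: "(\<lambda>u. (x \<odot> f) u + (y \<odot> g) u) \<in> {T. bop T \<and> rank_le smul T 2}"
    if "f \<in> dual" "g \<in> dual" for x y f g
    using bop_add[OF bop_tensor[OF that(1)] bop_tensor[OF that(2)]] rank_le_tensor2 by blast
  have H: "((\<forall>A\<in>\<A>. \<forall>B\<in>\<A>. rank_one A \<or> rank_one B \<longrightarrow> product_related A B) \<and>
        (\<forall>x y. \<forall>f\<in>dual. \<forall>g\<in>dual. (\<lambda>u. (x \<odot> f) u + (y \<odot> g) u) \<in> \<phi> ` \<A>)) \<or>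
      (r \<noteq> s \<and> (\<forall>A\<in>\<A>. \<forall>B\<in>\<A>. rank_one A \<or> rank_one B \<longrightarrow> jordan_related A B) \<and>
        (\<forall>x y z. \<forall>f\<in>dual. \<forall>g\<in>dual. \<forall>h\<in>dual. (\<lambda>u. (x \<odot> f) u + (y \<odot> g) u + (z \<odot> h) u) \<in> \<phi> ` \<A>))" (is ?goal)
  proof (rule hyp[THEN disjE])
    assume h: "{T. bop T \<and> rank_le smul T 2} \<subseteq> \<phi> ` \<A> \<and>
        (\<forall>a. (\<forall>j\<in>{1..k}. a j \<in> \<A>) \<and> (\<exists>j\<in>{1..k}. rank_le smul (a j) 1) \<longrightarrow>
          (\<exists>\<theta>. algebra_automorphism smul \<A> \<theta> \<and> gen_prod is (\<lambda>j. \<phi> (a j)) = \<theta> (gen_prod is a)))"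
    have "product_related A B" if AB: "A \<in> \<A>" "B \<in> \<A>" "rank_one A \<or> rank_one B" for A B
    proof -
      obtain \<theta> where "algebra_automorphism smul \<A> \<theta>"
        "gen_prod is (\<lambda>j. \<phi> (sub A B j)) = \<theta> (gen_prod is (sub A B))"
        using h[THEN conjunct2, rule_format, OF sub[OF AB]] by blast
      thus ?thesis unfolding product_related_def prod using algebra_automorphism_jordan by blast
    qed
    moreover have "(\<lambda>u. (x \<odot> f) u + (y \<odot> g) u) \<in> \<phi> ` \<A>" if "f \<in> dual" "g \<in> dual" for x y f g
      using subsetD[OF conjunct1[OF h] range2[OF that]] .
    ultimately show ?goal by blast
  next
    assume h: "{T. bop T \<and> rank_le smul T 3} \<subseteq> \<phi> ` \<A> \<and>
        (\<forall>a. (\<forall>j\<in>{1..k}. a j \<in> \<A>) \<and> (\<exists>j\<in>{1..k}. rank_le smul (a j) 1) \<longrightarrow>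
          (\<exists>\<theta>. jordan \<theta> \<and> gen_jordan_prod is (\<lambda>j. \<phi> (a j)) = \<theta> (gen_jordan_prod is a)))"
    have rel: "jordan_related A B" if AB: "A \<in> \<A>" "B \<in> \<A>" "rank_one A \<or> rank_one B" for A B
      using h[THEN conjunct2, rule_format, OF sub[OF AB]]
      unfolding gen_jordan_prod_def prod jordan_related_def .
    show ?goal
    proof (cases "r = s")
      \<comment> \<open>For r = s both halves of the Jordan product coincide, and halving yields the
        ordinary product relation, with more than the required range.\<close>
      case True
      have "product_related A B" if AB: "A \<in> \<A>" "B \<in> \<A>" "rank_one A \<or> rank_one B" for A B
      proof -
        let ?V = "A ^^ s \<circ> B \<circ> A ^^ s" and ?W = "\<phi> A ^^ s \<circ> \<phi> B \<circ> \<phi> A ^^ s"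
        obtain \<theta> where \<theta>: "jordan \<theta>" "(\<lambda>u. ?W u + ?W u) = \<theta> (\<lambda>u. ?V u + ?V u)"
          using rel[OF AB, unfolded jordan_related_def, unfolded True] by blast
        have V: "?V \<in> \<A>" by (rule A_sandwich[OF AB(1,2)])
        have "?W u = \<theta> ?V u" for u
          using fun_cong[OF \<theta>(2)[unfolded jordanD(2)[OF \<theta>(1) V V]], of u] by (rule double_cancel)
        hence "?W = \<theta> ?V" by (rule ext)
        thus ?thesis unfolding product_related_def unfolding True using \<theta>(1) by blast
      qed
      moreover have "(\<lambda>u. (x \<odot> f) u + (y \<odot> g) u) \<in> \<phi> ` \<A>" if "f \<in> dual" "g \<in> dual" for x y f g
      proof -
        have "(\<lambda>u. (x \<odot> f) u + (y \<odot> g) u) \<in> {T. bop T \<and> rank_le smul T 3}"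
          using range2[OF that] rank_le_mono[of _ 2 3] by simp
        thus ?thesis using conjunct1[OF h] by (rule rev_subsetD)
      qed
      ultimately show ?thesis by blast
    next
      case False
      have "(\<lambda>u. (x \<odot> f) u + (y \<odot> g) u + (z \<odot> h') u) \<in> \<phi> ` \<A>"
        if "f \<in> dual" "g \<in> dual" "h' \<in> dual" for x y z f g h'
      proof -
        have "(\<lambda>u. (x \<odot> f) u + (y \<odot> g) u + (z \<odot> h') u) \<in> {T. bop T \<and> rank_le smul T 3}"
          using rank_le_tensor3 that by (intro CollectI conjI bop_add bop_tensor)
        thus ?thesis using conjunct1[OF h] by (rule rev_subsetD)
      qed
      with False rel show ?thesis by blast
    qed
  qed
  interpret product_preserver smul \<A> \<phi> r s n by unfold_locales (rule H)
  show ?thesis using spatial_up_to_scalar unfolding len .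
qed

end
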